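(* Let $(V,\omega)$ be a nondegenerate simple CFT type vertex operator algebra and let $d=\dim V_1$. If there exists a chain $$0=\omega^0\prec\omega^1\prec\cdots\prec\omega^{d-1}\prec\omega^d=\omega$$ in $\mathrm{Sc}(V,\omega)$ such that $\dim C_V(C_V(\langle\omega^i-\omega^{i-1}\rangle))_1\neq0$ for $i=1,\dots,d$, then $(V,\omega)$ is isomorphic to the Heisenberg vertex operator algebra $(V_{\widehat{\mathfrak{h}}}(1,0),\omega_h)$ with $\mathfrak{h}=V_1$ for some $h\in V_1$.
   Context: Everything is over $\mathbb{C}$. Write $Y(u,z)=\sum_nu_nz^{-n-1}$. A vertex operator algebra $(V,\omega)$ is called nondegenerate simple CFT type if: (1) $V$ is simple, $\mathbb{N}$-graded (by eigenvalues of $L(0)=\omega_1$, with finite-dimensional pieces $V_n$), $V_0=\mathbb{C}\mathbf{1}$, and $V$ is generated by $V_1$ as a vertex algebra; (2) the symmetric bilinear form on $V_1$ defined by $u_1v=\langle u,v\rangle\mathbf{1}$ is nondegenerate. A vector $\omega'\in V$ is semi-conformal if it is the conformal vector of a vertex operator subalgebra $U$ of $V$ (possibly $\omega'\neq\omega$) such that $\omega_n|_U=\omega'_n|_U$ for all $n\ge0$; $\mathrm{Sc}(V,\omega)$ is the set of semi-conformal vectors. Partial order: for $\omega^1,\omega^2\in\mathrm{Sc}(V,\omega)$ put $L^i(n)=(\omega^i)_{n+1}$; $\omega^1\preceq\omega^2$ if and only if $L^2(0)\omega^1=2\omega^1$, $L^2(1)\omega^1=0$, $L^2(2)\omega^1=L^1(2)\omega^1$,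 $L^2(-1)\omega^1=L^1(-1)\omega^1$, and $L^2(n)\omega^1=0$ for all $n\ge3$. $\prec$ means $\preceq$ and $\neq$. $\langle S\rangle$ is the vertex subalgebra generated by $S$, $C_V(S)=\{v\in V\mid s_nv=0\ \forall s\in S,\ n\ge0\}$ is the commutant, and the subscript $1$ denotes the weight-one part, i.e. the intersection with $V_1$. Heisenberg vertex operator algebra: for a finite-dimensional space $\mathfrak{h}$ with nondegenerate symmetric bilinear form $\langle\cdot,\cdot\rangle$ (here $\mathfrak{h}=V_1$ with the bilinear form on $V_1$ defined by $u_1v=\langle u,v\rangle\mathbf{1}$ for $u,v\in V_1$), $\widehat{\mathfrak{h}}=\mathbb{C}[t,t^{-1}]\otimes\mathfrak{h}\oplus\mathbb{C}C$ is the Lie algebra with $C$ central and $[u\otimes t^m,v\otimes t^n]=m\langle u,v\rangle\delta_{m,-n}C$; $V_{\widehat{\mathfrak{h}}}(1,0)=U(\widehat{\mathfrak{h}})\otimes_{U(\widehat{\mathfrak{h}}^{\ge0})}\mathbb{C}\mathbf{1}$, where $\widehat{\mathfrak{h}}^{\ge0}=\mathbb{C}[t]\otimes\mathfrak{h}\oplus\mathbb{C}C$ acts on $\mathbb{C}\mathbf{1}$ with $\mathbb{C}[t]\otimes\mathfrak{h}$ acting by $0$ and $C$ by $1$; $u(n)$ is the action of $u\otimes t^n$, and the vertex algebra structure has vacuum $\mathbf{1}$ and $Y(u(-1)\mathbf{1},z)=\sum_nu(n)z^{-n-1}$. For $h\in\mathfrak{h}$ and an orthonormal basis $h_1,\dots,h_d$,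 the conformal vector is $\omega_h=\frac12\sum_ih_i(-1)^2\mathbf{1}+h(-2)\mathbf{1}$. *)

theory Defs
  imports Complex_Main "HOL-Library.Poly_Mapping" "HOL-Library.Product_Plus"
begin

section \<open>Vertex algebras and vertex operator algebras\<close>

text \<open>
  \<open>Y u n v\<close> is the product $u_n v$, i.e. $Y(u,z)v = \sum_n (u_n v) z^{-n-1}$.
  The underlying space is a subset \<open>U\<close> of an ambient complex vector space, so that the same
  predicates apply to vertex subalgebras.  The Jacobi identity is written in components
  (Borcherds identity).  All its sums are finite by truncation, so \<open>Sum_any\<close> is the real sum.
\<close>

locale vertex_algebra = vector_space scale
  for scale :: "complex \<Rightarrow> 'v::ab_group_add \<Rightarrow> 'v" +
  fixes U :: "'v set" and vac :: 'v and Y :: "'v \<Rightarrow> int \<Rightarrow> 'v \<Rightarrow> 'v"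
  assumes space_subspace: "subspace U"
    and vac_in: "vac \<in> U"
    and prod_in: "\<And>u v n. u \<in> U \<Longrightarrow> v \<in> U \<Longrightarrow> Y u n v \<in> U"
    and prod_add_left: "\<And>u u' v n. u \<in> U \<Longrightarrow> u' \<in> U \<Longrightarrow> v \<in> U \<Longrightarrow>
          Y (u + u') n v = Y u n v + Y u' n v"
    and prod_add_right: "\<And>u v v' n. u \<in> U \<Longrightarrow> v \<in> U \<Longrightarrow> v' \<in> U \<Longrightarrow>
          Y u n (v + v') = Y u n v + Y u n v'"
    and prod_scale_left: "\<And>c u v n. u \<in> U \<Longrightarrow> v \<in> U \<Longrightarrow> Y (scale c u) n v = scale c (Y u n v)"
    and prod_scale_right: "\<And>c u v n. u \<in> U \<Longrightarrow> v \<in> U \<Longrightarrow> Y u n (scale c v) = scale c (Y u n v)"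
    and truncation: "\<And>u v. u \<in> U \<Longrightarrow> v \<in> U \<Longrightarrow> \<exists>N. \<forall>n\<ge>N. Y u n v = 0"
    and vacuum: "\<And>v n. v \<in> U \<Longrightarrow> Y vac n v = (if n = -1 then v else 0)"
    and creation: "\<And>v. v \<in> U \<Longrightarrow> Y v (-1) vac = v"
    and creation_nonneg: "\<And>v n. v \<in> U \<Longrightarrow> n \<ge> 0 \<Longrightarrow> Y v n vac = 0"
    and borcherds: "\<And>u v w m n k. u \<in> U \<Longrightarrow> v \<in> U \<Longrightarrow> w \<in> U \<Longrightarrow>
          Sum_any (\<lambda>i::nat. scale (of_int m gchoose i) (Y (Y u (n + int i) v) (m + k - int i) w)) =
          Sum_any (\<lambda>i::nat. scale ((-1) ^ i * (of_int n gchoose i))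
             (Y u (m + n - int i) (Y v (k + int i) w)
              - scale ((-1) powi n) (Y v (n + k - int i) (Y u (m + int i) w))))"

definition weight_space ::
  "(complex \<Rightarrow> 'v::ab_group_add \<Rightarrow> 'v) \<Rightarrow> 'v set \<Rightarrow> ('v \<Rightarrow> int \<Rightarrow> 'v \<Rightarrow> 'v) \<Rightarrow> 'v \<Rightarrow> int \<Rightarrow> 'v set"
  where "weight_space scale U Y \<omega> n = {v \<in> U. Y \<omega> 1 v = scale (of_int n) v}"

text \<open>
  $L(n) = \omega_{n+1}$.  Eigenspaces are independent, so \<open>grading\<close> says that the space is the
  direct sum of its weight spaces.
\<close>

locale vertex_operator_algebra = vertex_algebra scale U vac Y
  for scale :: "complex \<Rightarrow> 'v::ab_group_add \<Rightarrow> 'v"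
    and U :: "'v set" and vac :: 'v and Y :: "'v \<Rightarrow> int \<Rightarrow> 'v \<Rightarrow> 'v" +
  fixes \<omega> :: 'v
  assumes omega_in: "\<omega> \<in> U"
    and virasoro: "\<exists>c::complex. \<forall>m n. \<forall>v\<in>U.
          Y \<omega> (m + 1) (Y \<omega> (n + 1) v) - Y \<omega> (n + 1) (Y \<omega> (m + 1) v) =
          scale (of_int (m - n)) (Y \<omega> (m + n + 1) v)
          + (if m + n = 0 then scale (of_int (m ^ 3 - m) / 12 * c) v else 0)"
    and L_derivative: "\<And>v w n. v \<in> U \<Longrightarrow> w \<in> U \<Longrightarrow>
          Y (Y \<omega> 0 v) n w = scale (- of_int n) (Y v (n - 1) w)"
    and grading: "U \<subseteq> span (\<Union>n. weight_space scale U Y \<omega> n)"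
    and weight_space_finite_dim: "\<And>n. \<exists>B. finite B \<and> weight_space scale U Y \<omega> n \<subseteq> span B"
    and weights_bounded_below: "\<exists>N. \<forall>n<N. weight_space scale U Y \<omega> n = {0}"

definition vertex_subalgebra ::
  "(complex \<Rightarrow> 'v::ab_group_add \<Rightarrow> 'v) \<Rightarrow> 'v \<Rightarrow> ('v \<Rightarrow> int \<Rightarrow> 'v \<Rightarrow> 'v) \<Rightarrow> 'v set \<Rightarrow> bool"
  where "vertex_subalgebra scale vac Y U \<longleftrightarrow>
    module.subspace scale U \<and> vac \<in> U \<and> (\<forall>u\<in>U. \<forall>v\<in>U. \<forall>n. Y u n v \<in> U)"

definition generated_subalgebra ::
  "(complex \<Rightarrow> 'v::ab_group_add \<Rightarrow> 'v) \<Rightarrow> 'v \<Rightarrow> ('v \<Rightarrow> int \<Rightarrow> 'v \<Rightarrow> 'v) \<Rightarrow> 'v set \<Rightarrow> 'v set"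
  where "generated_subalgebra scale vac Y S = \<Inter>{U. vertex_subalgebra scale vac Y U \<and> S \<subseteq> U}"

definition commutant :: "('v::zero \<Rightarrow> int \<Rightarrow> 'v \<Rightarrow> 'v) \<Rightarrow> 'v set \<Rightarrow> 'v set"
  where "commutant Y S = {v. \<forall>s\<in>S. \<forall>n\<ge>0. Y s n v = 0}"

definition vertex_ideal ::
  "(complex \<Rightarrow> 'v::ab_group_add \<Rightarrow> 'v) \<Rightarrow> ('v \<Rightarrow> int \<Rightarrow> 'v \<Rightarrow> 'v) \<Rightarrow> 'v set \<Rightarrow> bool"
  where "vertex_ideal scale Y I \<longleftrightarrow>
    module.subspace scale I \<and> (\<forall>u. \<forall>v\<in>I. \<forall>n. Y u n v \<in> I \<and> Y v n u \<in> I)"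

definition simple_vertex_algebra ::
  "(complex \<Rightarrow> 'v::ab_group_add \<Rightarrow> 'v) \<Rightarrow> ('v \<Rightarrow> int \<Rightarrow> 'v \<Rightarrow> 'v) \<Rightarrow> bool"
  where "simple_vertex_algebra scale Y \<longleftrightarrow>
    (UNIV :: 'v set) \<noteq> {0} \<and> (\<forall>I. vertex_ideal scale Y I \<longrightarrow> I = {0} \<or> I = UNIV)"

text \<open>$u_1 v = \langle u, v\rangle \mathbf 1$; only meaningful for \<open>u\<close>, \<open>v\<close> of weight one.\<close>

definition V1_form ::
  "(complex \<Rightarrow> 'v \<Rightarrow> 'v) \<Rightarrow> 'v \<Rightarrow> ('v \<Rightarrow> int \<Rightarrow> 'v \<Rightarrow> 'v) \<Rightarrow> 'v \<Rightarrow> 'v \<Rightarrow> complex"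
  where "V1_form scale vac Y u v = (THE c. Y u 1 v = scale c vac)"

definition nondegenerate_simple_CFT_type ::
  "(complex \<Rightarrow> 'v::ab_group_add \<Rightarrow> 'v) \<Rightarrow> 'v \<Rightarrow> ('v \<Rightarrow> int \<Rightarrow> 'v \<Rightarrow> 'v) \<Rightarrow> 'v \<Rightarrow> bool"
  where "nondegenerate_simple_CFT_type scale vac Y \<omega> \<longleftrightarrow>
    (let V1 = weight_space scale UNIV Y \<omega> 1 in
     vertex_operator_algebra scale UNIV vac Y \<omega> \<and>
     simple_vertex_algebra scale Y \<and>
     (\<forall>n<0. weight_space scale UNIV Y \<omega> n = {0}) \<and>
     weight_space scale UNIV Y \<omega> 0 = range (\<lambda>c. scale c vac) \<and>
     generated_subalgebra scale vac Y V1 = UNIV \<and>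
     (\<forall>u\<in>V1. (\<forall>v\<in>V1. V1_form scale vac Y u v = 0) \<longrightarrow> u = 0))"

definition voa_isomorphic ::
  "(complex \<Rightarrow> 'v::ab_group_add \<Rightarrow> 'v) \<Rightarrow> 'v set \<Rightarrow> 'v \<Rightarrow> ('v \<Rightarrow> int \<Rightarrow> 'v \<Rightarrow> 'v) \<Rightarrow> 'v \<Rightarrow>
   (complex \<Rightarrow> 'w::ab_group_add \<Rightarrow> 'w) \<Rightarrow> 'w set \<Rightarrow> 'w \<Rightarrow> ('w \<Rightarrow> int \<Rightarrow> 'w \<Rightarrow> 'w) \<Rightarrow> 'w \<Rightarrow> bool"
  where "voa_isomorphic scale U vac Y \<omega> scale' U' vac' Y' \<omega>' \<longleftrightarrow>
    (\<exists>f. bij_betw f U U' \<and>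
      (\<forall>u\<in>U. \<forall>v\<in>U. f (u + v) = f u + f v) \<and>
      (\<forall>c. \<forall>u\<in>U. f (scale c u) = scale' c (f u)) \<and>
      f vac = vac' \<and>
      (\<forall>u\<in>U. \<forall>v\<in>U. \<forall>n. f (Y u n v) = Y' (f u) n (f v)) \<and>
      f \<omega> = \<omega>')"

section \<open>Semi-conformal vectors\<close>

definition semi_conformal ::
  "(complex \<Rightarrow> 'v::ab_group_add \<Rightarrow> 'v) \<Rightarrow> 'v \<Rightarrow> ('v \<Rightarrow> int \<Rightarrow> 'v \<Rightarrow> 'v) \<Rightarrow> 'v \<Rightarrow> 'v set"
  where "semi_conformal scale vac Y \<omega> =
    {\<omega>'. \<exists>U. vertex_subalgebra scale vac Y U \<and> vertex_operator_algebra scale U vac Y \<omega>' \<and>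
          (\<forall>n\<ge>0. \<forall>u\<in>U. Y \<omega> n u = Y \<omega>' n u)}"

text \<open>The relation $\omega^1 \preceq \omega^2$; recall $L^i(n) = (\omega^i)_{n+1}$.\<close>

definition sc_le ::
  "(complex \<Rightarrow> 'v::ab_group_add \<Rightarrow> 'v) \<Rightarrow> ('v \<Rightarrow> int \<Rightarrow> 'v \<Rightarrow> 'v) \<Rightarrow> 'v \<Rightarrow> 'v \<Rightarrow> bool"
  where "sc_le scale Y \<omega>1 \<omega>2 \<longleftrightarrow>
    (let L1 = (\<lambda>n. Y \<omega>1 (n + 1)); L2 = (\<lambda>n. Y \<omega>2 (n + 1)) in
     L2 0 \<omega>1 = scale 2 \<omega>1 \<and> L2 1 \<omega>1 = 0 \<and> L2 2 \<omega>1 = L1 2 \<omega>1 \<and>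
     L2 (-1) \<omega>1 = L1 (-1) \<omega>1 \<and> (\<forall>n\<ge>3. L2 n \<omega>1 = 0))"

definition sc_less ::
  "(complex \<Rightarrow> 'v::ab_group_add \<Rightarrow> 'v) \<Rightarrow> ('v \<Rightarrow> int \<Rightarrow> 'v \<Rightarrow> 'v) \<Rightarrow> 'v \<Rightarrow> 'v \<Rightarrow> bool"
  where "sc_less scale Y \<omega>1 \<omega>2 \<longleftrightarrow> sc_le scale Y \<omega>1 \<omega>2 \<and> \<omega>1 \<noteq> \<omega>2"

section \<open>Quotients, tensor products, enveloping algebras\<close>

text \<open>
  \<open>coset_rep scale N\<close> linearly picks a representative in every coset of the subspace \<open>N\<close>: it is
  linear, has kernel \<open>N\<close> and maps \<open>x\<close> into \<open>x + N\<close>.  For a subspace \<open>M\<close> containing \<open>N\<close> the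
  quotient \<open>M/N\<close> is realised as \<open>coset_rep scale N ` M\<close>, with quotient map \<open>coset_rep scale N\<close>;
  this keeps quotients by term-dependent subspaces inside a type of class \<open>ab_group_add\<close>.
\<close>

definition coset_rep :: "(complex \<Rightarrow> 'v::ab_group_add \<Rightarrow> 'v) \<Rightarrow> 'v set \<Rightarrow> 'v \<Rightarrow> 'v"
  where "coset_rep scale N = (SOME p. Vector_Spaces.linear scale scale p \<and>
           (\<forall>x. x - p x \<in> N) \<and> (\<forall>x\<in>N. p x = 0))"

lemma coset_rep:
  assumes "vector_space scale" and N: "module.subspace scale N"
  shows "Vector_Spaces.linear scale scale (coset_rep scale N)"
    and "x - coset_rep scale N x \<in> N"
    and "coset_rep scale N x = 0 \<longleftrightarrow> x \<in> N"
proof -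
  interpret vector_space scale by fact
  interpret P: vector_space_pair scale scale ..
  obtain B where B: "B \<subseteq> N" "independent B" "N \<subseteq> span B"
    using maximal_independent_subset by blast
  define E where "E = extend_basis B"
  have E: "B \<subseteq> E" "independent E" "span E = UNIV"
    unfolding E_def using B(2) extend_basis_superset independent_extend_basis span_extend_basis
    by blast+
  define p where "p = P.construct E (\<lambda>b. if b \<in> B then 0 else b)"
  have lin: "Vector_Spaces.linear scale scale p"
    unfolding p_def using E(2) by (rule P.linear_construct)
  interpret p: Vector_Spaces.linear scale scale p by fact
  have pb: "p b = (if b \<in> B then 0 else b)" if "b \<in> E" for b
    unfolding p_def using P.construct_basis[OF E(2) that] by simp
  have mem: "x - p x \<in> N" for x
  proof -
    have "x \<in> span E" using E(3) by simp
    then show ?thesis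
    proof (induction rule: span_induct_alt)
      case base
      then show ?case using subspace_0[OF N] by (simp add: p.zero)
    next
      case (step c b y)
      have "b - p b \<in> N"
        using pb[OF step(1)] B(1) subspace_0[OF N] by auto
      then have "scale c (b - p b) + (y - p y) \<in> N"
        using step(2) subspace_add[OF N] subspace_scale[OF N] by blast
      then show ?case
        by (simp add: p.add p.scale scale_right_diff_distrib algebra_simps)
    qed
  qed
  have ker: "p x = 0" if "x \<in> N" for x
  proof -
    have "x \<in> span B" using that B(3) by blast
    then show ?thesis
    proof (induction rule: span_induct_alt)
      case base
      then show ?case by (simp add: p.zero)
    next
      case (step c b y)
      then show ?case using pb[of b] E(1) by (auto simp: p.add p.scale)
    qed
  qed
  have "Vector_Spaces.linear scale scale (coset_rep scale N) \<and>
      (\<forall>x. x - coset_rep scale N x \<in> N) \<and> (\<forall>x\<in>N. coset_rep scale N x = 0)"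
    unfolding coset_rep_def by (rule someI[of _ p]) (use lin mem ker in blast)
  then show "Vector_Spaces.linear scale scale (coset_rep scale N)"
    "x - coset_rep scale N x \<in> N" "coset_rep scale N x = 0 \<longleftrightarrow> x \<in> N"
    by (auto, metis diff_zero)
qed

text \<open>Scalar multiplication on the free vector space \<open>'k \<Rightarrow>\<^sub>0 complex\<close> with basis \<open>'k\<close>.\<close>

definition fscale :: "complex \<Rightarrow> ('k \<Rightarrow>\<^sub>0 complex) \<Rightarrow> ('k \<Rightarrow>\<^sub>0 complex)"
  where "fscale c = Poly_Mapping.map ((*) c)"

lemma lookup_fscale [simp]: "Poly_Mapping.lookup (fscale c x) k = c * Poly_Mapping.lookup x k"
  by (simp add: fscale_def Poly_Mapping.map.rep_eq when_def)

lemma vector_space_fscale: "vector_space fscale"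
  by unfold_locales (auto intro!: poly_mapping_eqI simp: lookup_add algebra_simps)

text \<open>
  Words with concatenation as addition, so that \<open>'g fword \<Rightarrow>\<^sub>0 complex\<close> with the convolution
  product is the free unital associative algebra on \<open>'g\<close>.
\<close>

datatype 'g fword = FWord (letters: "'g list")

instantiation fword :: (type) monoid_add
begin

definition zero_fword :: "'a fword" where "zero_fword = FWord []"

definition plus_fword :: "'a fword \<Rightarrow> 'a fword \<Rightarrow> 'a fword"
  where "plus_fword u v = FWord (letters u @ letters v)"

instance by standard (simp_all add: zero_fword_def plus_fword_def)

end

type_synonym 'g free_alg = "'g fword \<Rightarrow>\<^sub>0 complex"

definition letter :: "'g \<Rightarrow> 'g free_alg"
  where "letter x = Poly_Mapping.single (FWord [x]) 1"

definition free_alg_on :: "'g set \<Rightarrow> 'g free_alg set"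
  where "free_alg_on G = {a. \<forall>w\<in>Poly_Mapping.keys a. set (letters w) \<subseteq> G}"

text \<open>
  The universal enveloping algebra $U(G)$ of a Lie algebra \<open>G\<close>.  The first two families of
  relations turn the free algebra on the set \<open>G\<close> into the tensor algebra $T(G)$.
\<close>

definition env_relations ::
  "(complex \<Rightarrow> 'g::ab_group_add \<Rightarrow> 'g) \<Rightarrow> ('g \<Rightarrow> 'g \<Rightarrow> 'g) \<Rightarrow> 'g set \<Rightarrow> 'g free_alg set"
  where "env_relations sc br G =
    {letter (x + y) - letter x - letter y | x y. x \<in> G \<and> y \<in> G} \<union>
    {letter (sc c x) - fscale c (letter x) | c x. x \<in> G} \<union>
    {letter x * letter y - letter y * letter x - letter (br x y) | x y. x \<in> G \<and> y \<in> G}"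

definition env_rep ::
  "(complex \<Rightarrow> 'g::ab_group_add \<Rightarrow> 'g) \<Rightarrow> ('g \<Rightarrow> 'g \<Rightarrow> 'g) \<Rightarrow> 'g set \<Rightarrow> 'g free_alg \<Rightarrow> 'g free_alg"
  where "env_rep sc br G = coset_rep fscale (module.span fscale
    {a * r * b | a r b. a \<in> free_alg_on G \<and> b \<in> free_alg_on G \<and> r \<in> env_relations sc br G})"

definition env_alg ::
  "(complex \<Rightarrow> 'g::ab_group_add \<Rightarrow> 'g) \<Rightarrow> ('g \<Rightarrow> 'g \<Rightarrow> 'g) \<Rightarrow> 'g set \<Rightarrow> 'g free_alg set"
  where "env_alg sc br G = env_rep sc br G ` free_alg_on G"

text \<open>
  The tensor product over an algebra \<open>R\<close> of a right module \<open>M\<close> (action \<open>ra\<close>) and a left module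
  \<open>N\<close> (action \<open>la\<close>), as a quotient of the free vector space on \<open>M \<times> N\<close>.  The class of
  \<open>single (x, w) 1\<close> is the pure tensor of \<open>x\<close> and \<open>w\<close>.
\<close>

definition tensor_relations ::
  "'r set \<Rightarrow> (complex \<Rightarrow> 'm::ab_group_add \<Rightarrow> 'm) \<Rightarrow> 'm set \<Rightarrow> ('m \<Rightarrow> 'r \<Rightarrow> 'm) \<Rightarrow>
   (complex \<Rightarrow> 'n::ab_group_add \<Rightarrow> 'n) \<Rightarrow> 'n set \<Rightarrow> ('r \<Rightarrow> 'n \<Rightarrow> 'n) \<Rightarrow> (('m \<times> 'n) \<Rightarrow>\<^sub>0 complex) set"
  where "tensor_relations R sM M ra sN N la =
    (let t = (\<lambda>x w. Poly_Mapping.single (x, w) (1::complex)) in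
      {t (x + x') w - t x w - t x' w | x x' w. x \<in> M \<and> x' \<in> M \<and> w \<in> N} \<union>
      {t x (w + w') - t x w - t x w' | x w w'. x \<in> M \<and> w \<in> N \<and> w' \<in> N} \<union>
      {t (sM c x) w - fscale c (t x w) | c x w. x \<in> M \<and> w \<in> N} \<union>
      {t x (sN c w) - fscale c (t x w) | c x w. x \<in> M \<and> w \<in> N} \<union>
      {t (ra x b) w - t x (la b w) | x b w. x \<in> M \<and> b \<in> R \<and> w \<in> N})"

section \<open>The Heisenberg vertex operator algebra\<close>

text \<open>
  $\mathbb C[t,t^{-1}] \otimes \mathfrak h$ is the space of finitely supported functions from the
  integers to $\mathfrak h$: \<open>single n u\<close> is $u \otimes t^n$.  The second component of a pair is
  the coefficient of the central element $C$.
\<close>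

type_synonym 'v heis_elt = "(int \<Rightarrow>\<^sub>0 'v) \<times> complex"

definition heis_scale :: "(complex \<Rightarrow> 'v::ab_group_add \<Rightarrow> 'v) \<Rightarrow> complex \<Rightarrow> 'v heis_elt \<Rightarrow> 'v heis_elt"
  where "heis_scale scale c x = (Poly_Mapping.map (scale c) (fst x), c * snd x)"

definition heis_bracket ::
  "('v::ab_group_add \<Rightarrow> 'v \<Rightarrow> complex) \<Rightarrow> 'v heis_elt \<Rightarrow> 'v heis_elt \<Rightarrow> 'v heis_elt"
  where "heis_bracket form x y =
    (0, \<Sum>m\<in>Poly_Mapping.keys (fst x).
          of_int m * form (Poly_Mapping.lookup (fst x) m) (Poly_Mapping.lookup (fst y) (- m)))"

lemma heis_bracket_single:
  assumes "\<And>u. form u 0 = 0" "\<And>v. form 0 v = 0"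
  shows "heis_bracket form (Poly_Mapping.single m u, a) (Poly_Mapping.single n v, b) =
    (0, if m = - n then of_int m * form u v else 0)"
  using assms by (auto simp: heis_bracket_def lookup_single when_def)

definition heis_alg :: "'v::ab_group_add set \<Rightarrow> 'v heis_elt set"
  where "heis_alg \<hh> = {x. \<forall>n. Poly_Mapping.lookup (fst x) n \<in> \<hh>}"

definition heis_alg_nonneg :: "'v::ab_group_add set \<Rightarrow> 'v heis_elt set"
  where "heis_alg_nonneg \<hh> = {x \<in> heis_alg \<hh>. \<forall>n<0. Poly_Mapping.lookup (fst x) n = 0}"

text \<open>
  The action of $U(\widehat{\mathfrak h}^{\ge 0})$ on $\mathbb C\mathbf 1$: the element
  $f + cC$ of $\widehat{\mathfrak h}^{\ge 0}$ acts as multiplication by $c$.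
\<close>

definition heis_vac_action :: "'v heis_elt free_alg \<Rightarrow> complex \<Rightarrow> complex"
  where "heis_vac_action b z =
    (\<Sum>w\<in>Poly_Mapping.keys b. Poly_Mapping.lookup b w * prod_list (map snd (letters w))) * z"

type_synonym 'v heis_tensor = "('v heis_elt free_alg \<times> complex) \<Rightarrow>\<^sub>0 complex"

locale heisenberg =
  fixes scale :: "complex \<Rightarrow> 'v::ab_group_add \<Rightarrow> 'v"
    and \<hh> :: "'v set" and form :: "'v \<Rightarrow> 'v \<Rightarrow> complex"
begin

abbreviation "U_rep \<equiv> env_rep (heis_scale scale) (heis_bracket form) (heis_alg \<hh>)"

abbreviation "U_alg \<equiv> env_alg (heis_scale scale) (heis_bracket form) (heis_alg \<hh>)"

abbreviation "U_nonneg \<equiv> env_alg (heis_scale scale) (heis_bracket form) (heis_alg_nonneg \<hh>)"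

definition space_rep :: "'v heis_tensor \<Rightarrow> 'v heis_tensor"
  where "space_rep = coset_rep fscale (module.span fscale
    (tensor_relations U_nonneg fscale U_alg (\<lambda>x b. U_rep (x * b)) (*) UNIV heis_vac_action))"

text \<open>The induced module, its vacuum vector, and the action $u(n)$ of $u \otimes t^n$ on it.\<close>

definition space :: "'v heis_tensor set"
  where "space = space_rep ` {y. Poly_Mapping.keys y \<subseteq> U_alg \<times> UNIV}"

definition vac :: "'v heis_tensor"
  where "vac = space_rep (Poly_Mapping.single (U_rep 1, 1) 1)"

definition act :: "'v \<Rightarrow> int \<Rightarrow> 'v heis_tensor \<Rightarrow> 'v heis_tensor"
  where "act u n y = space_rep (\<Sum>(x, z)\<in>Poly_Mapping.keys y.
    Poly_Mapping.single (U_rep (letter (Poly_Mapping.single n u, 0) * x), z)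
      (Poly_Mapping.lookup y (x, z)))"

text \<open>
  \<open>is_vertex_structure Y\<close>: \<open>Y\<close> is the vertex algebra structure on the induced module, which is
  determined by the vacuum and by $(u(-1)\mathbf 1)_n = u(n)$.
\<close>

definition is_vertex_structure ::
  "('v heis_tensor \<Rightarrow> int \<Rightarrow> 'v heis_tensor \<Rightarrow> 'v heis_tensor) \<Rightarrow> bool"
  where "is_vertex_structure Y \<longleftrightarrow>
    vertex_algebra fscale space vac Y \<and>
    (\<forall>u\<in>\<hh>. \<forall>n. \<forall>w\<in>space. Y (act u (-1) vac) n w = act u n w)"

definition orthonormal_basis :: "'v set \<Rightarrow> bool"
  where "orthonormal_basis B \<longleftrightarrow> finite B \<and> B \<subseteq> \<hh> \<and> module.span scale B = \<hh> \<and>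
    (\<forall>b\<in>B. \<forall>b'\<in>B. form b b' = (if b = b' then 1 else 0))"

text \<open>$\omega_h$ computed with the orthonormal basis \<open>B\<close>; it does not depend on the choice of \<open>B\<close>.\<close>

definition conformal :: "'v set \<Rightarrow> 'v \<Rightarrow> 'v heis_tensor"
  where "conformal B h =
    fscale (1/2) (\<Sum>b\<in>B. act b (-1) (act b (-1) vac)) + act h (-2) vac"

end

end

theory Submission
  imports Defs
begin

text \<open>
  The argument has two halves: the chain forces the Lie algebra $V_1$ to be abelian, and a vertex
  operator algebra of the given type with abelian $V_1$ is a Heisenberg vertex operator algebra.

  \<^bold>\<open>The chain.\<close>  Write $e_i = \omega^i - \omega^{i-1}$, so that $\sum_i e_i = \omega$.  The
  relation $\omega^{i-1} \preceq \omega^i$ says exactly that $(e_i)_n \omega^{i-1} = 0$ for $n \ge 0$.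
  That $e_i$ also commutes with the earlier $\omega^j$ rests on one lemma,
  \<open>commuting_of_translation\<close>: if $a_0 x = 0$ and $a_0 v = L(-1)v$, then $x_n v = 0$ for all
  $n \ge 0$.  Indeed $a_0$ commutes with all $x_n$, which turns $x_n v = 0$ into
  $n\,x_{n-1} v = 0$, and truncation starts the descent.  Taking $a = \omega^i$, $x = e_{i+1}$,
  $v = \omega^j$, an induction on $i$ gives $(\omega^i)_0\omega^j = L(-1)\omega^j$ for $j \le i$ and
  hence $(e_i)_n e_j = 0$ for $i \ne j$, $n \ge 0$.

  Choose $0 \ne x_i \in C_V(C_V(\langle e_i\rangle))_1$.  As $e_j \in C_V(\langle e_i\rangle)$ for
  $j \ne i$, the operators $(e_j)_1$ annihilate $x_i$, so $(e_i)_1 x_i = \omega_1 x_i = x_i$.  Thus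
  $x_1, \dots, x_d$ are joint eigenvectors with distinct eigenvalue systems, hence a basis of $V_1$,
  and $x_i \in C_V(\langle e_j\rangle)$ gives $(x_i)_n x_j = 0$ for $i \ne j$, $n \ge 0$.  So $V_1$ is
  abelian and the basis is orthogonal; nondegeneracy of the form allows it to be normalised.

  \<^bold>\<open>The isomorphism.\<close>  The modes of an orthonormal basis now satisfy the Heisenberg relations on
  $V$, and $V$ is spanned by words in them applied to the vacuum because $V_1$ generates $V$.  The
  universal property of the induced module gives a linear map $T$ from it onto $V$ which intertwines
  the modes.  It is injective because a Heisenberg module generated by a vacuum is irreducible
  (\<open>irreducible\<close>): the energy operator $\sum_{b}\sum_{n>0} b(-n)b(n)$ acts on a monomial of
  degree $k$ as $k$, so a vector killed by all $b(n)$ with $n > 0$ is a multiple of the vacuum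
  (\<open>singular_vector\<close>).  The vertex algebra structure on the induced module is the one of $V$
  transported along $T$.  Finally $h$ is chosen so that
  $\omega - \frac12\sum_b b(-1)^2\mathbf 1 - h(-2)\mathbf 1$ is killed by all $b(n)$, $n > 0$; being
  a multiple of the vacuum and of weight two, this difference vanishes.
\<close>

section \<open>Calculus in a vertex algebra\<close>

locale full_vertex_algebra = vertex_algebra scale UNIV vac Y
  for scale :: "complex \<Rightarrow> 'v::ab_group_add \<Rightarrow> 'v" and vac :: 'v and Y :: "'v \<Rightarrow> int \<Rightarrow> 'v \<Rightarrow> 'v"
begin

lemmas Y_add_left = prod_add_left[OF UNIV_I UNIV_I UNIV_I]
lemmas Y_add_right = prod_add_right[OF UNIV_I UNIV_I UNIV_I]
lemmas Y_scale_left = prod_scale_left[OF UNIV_I UNIV_I]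
lemmas Y_scale_right = prod_scale_right[OF UNIV_I UNIV_I]
lemmas Y_vac = vacuum[OF UNIV_I]
lemmas Y_creation = creation[OF UNIV_I]
lemmas Y_creation_nonneg = creation_nonneg[OF UNIV_I]

lemma linear_Y_left: "Vector_Spaces.linear scale scale (\<lambda>u. Y u n v)"
  by unfold_locales (simp_all add: Y_add_left Y_scale_left)

lemma linear_Y_right: "Vector_Spaces.linear scale scale (Y u n)"
  by unfold_locales (simp_all add: Y_add_right Y_scale_right)

sublocale Y_left: Vector_Spaces.linear scale scale "\<lambda>u. Y u n v" for n v
  by (rule linear_Y_left)

sublocale Y_right: Vector_Spaces.linear scale scale "Y u n" for u n
  by (rule linear_Y_right)

lemmas Y_simps [simp] = Y_left.zero Y_right.zero Y_left.neg Y_right.neg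

lemma Y_vac_scale: "Y (scale c vac) n v = (if n = -1 then scale c v else 0)"
  by (simp add: Y_scale_left Y_vac)

lemma Sum_any_mem_subspace:
  assumes "subspace S" "\<And>i. g i \<in> S"
  shows "Sum_any g \<in> S"
  unfolding Sum_any.expand_set using assms by (intro subspace_sum)

text \<open>
  The case $n = 0$ of the Borcherds identity.
\<close>

lemma commutator:
  "Y u m (Y v k w) - Y v k (Y u m w) =
    Sum_any (\<lambda>i::nat. scale (of_int m gchoose i) (Y (Y u (int i) v) (m + k - int i) w))"
proof -
  let ?g = "\<lambda>i::nat. Y u (m - int i) (Y v (k + int i) w) - Y v (k - int i) (Y u (m + int i) w)"
  have "Sum_any (\<lambda>i::nat. scale ((-1) ^ i * (0 gchoose i)) (?g i)) =
      Sum_any (\<lambda>i::nat. if i = 0 then ?g i else 0)"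
  proof (rule Sum_any.cong)
    fix i show "scale ((-1) ^ i * (0 gchoose i)) (?g i) = (if i = 0 then ?g i else 0)"
      by (cases i) simp_all
  qed
  then show ?thesis
    using borcherds[of u v w m 0 k] by simp
qed

text \<open>
  The case $m = 0$ of the Borcherds identity.
\<close>

lemma iterate:
  "Y (Y u n v) k w = Sum_any (\<lambda>i::nat. scale ((-1) ^ i * (of_int n gchoose i))
     (Y u (n - int i) (Y v (k + int i) w) - scale ((-1) powi n) (Y v (n + k - int i) (Y u (int i) w))))"
proof -
  have "Sum_any (\<lambda>i::nat. scale (0 gchoose i) (Y (Y u (n + int i) v) (k - int i) w)) =
      Sum_any (\<lambda>i::nat. if i = 0 then Y (Y u (n + int i) v) (k - int i) w else 0)"
  proof (rule Sum_any.cong)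
    fix i show "scale (0 gchoose i) (Y (Y u (n + int i) v) (k - int i) w) =
      (if i = 0 then Y (Y u (n + int i) v) (k - int i) w else 0)"
      by (cases i) simp_all
  qed
  then show ?thesis
    using borcherds[of u v w 0 n k] by simp
qed

text \<open>
  The Borcherds identity for $w = \mathbf 1$, $m = -1$, $k = 0$: on its right-hand side only
  $v_n u_{-1}\mathbf 1$ survives.  The term $a_{-1-i}\mathbf 1$ is $L(-1)^i a / i!$, so this is the usual
  formula, stated without reference to a conformal vector.
\<close>

lemma skew_symmetry:
  "Y v n u = - scale ((-1) powi n)
    (Sum_any (\<lambda>i::nat. scale ((-1) ^ i) (Y (Y u (n + int i) v) (- 1 - int i) vac)))"
proof -
  have m1: "((-1::complex) gchoose i) = (-1) ^ i" for i
    using gbinomial_minus[of "1::complex" i] binomial_gbinomial[of i i, where 'a=complex] by simp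
  have "Sum_any (\<lambda>i::nat. scale ((-1) ^ i * (of_int n gchoose i))
             (Y u (- 1 + n - int i) (Y v (0 + int i) vac)
              - scale ((-1) powi n) (Y v (n + 0 - int i) (Y u (- 1 + int i) vac)))) =
      Sum_any (\<lambda>i::nat. if i = 0 then - scale ((-1) powi n) (Y v n u) else 0)"
  proof (rule Sum_any.cong)
    fix i show "scale ((-1) ^ i * (of_int n gchoose i))
             (Y u (- 1 + n - int i) (Y v (0 + int i) vac)
              - scale ((-1) powi n) (Y v (n + 0 - int i) (Y u (- 1 + int i) vac))) =
      (if i = 0 then - scale ((-1) powi n) (Y v n u) else 0)"
      by (cases i) (simp_all add: Y_creation Y_creation_nonneg)
  qed
  then have eq: "- scale ((-1) powi n) (Y v n u) =
      Sum_any (\<lambda>i::nat. scale ((-1) ^ i) (Y (Y u (n + int i) v) (- 1 - int i) vac))"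
    using borcherds[of u v vac "-1" n 0] by (simp add: m1)
  have "((-1) powi n) * ((-1) powi n) = (1::complex)"
    by (auto simp: power_int_minus_left)
  then show ?thesis unfolding eq[symmetric] by simp
qed

lemma Sum_any_lessThan:
  assumes "\<And>i. i \<ge> N \<Longrightarrow> g i = 0"
  shows "Sum_any g = (\<Sum>i<N. (g (i::nat)) :: 'v)"
  by (rule Sum_any.expand_superset) (use assms in \<open>auto simp: not_le[symmetric]\<close>)

lemma commuting_sym:
  assumes "\<And>n. n \<ge> 0 \<Longrightarrow> Y u n v = 0" "n \<ge> 0"
  shows "Y v n u = 0"
  by (subst skew_symmetry) (simp add: assms)

text \<open>
  By the iterate formula every term of $(u_kv)_nx$ with $n \ge 0$ contains $v_{n+i}x$ or $u_ix$ with a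
  nonnegative index.  Hence commuting with $x$ can be tested on generators.
\<close>

lemma subalgebra_commuting:
  "vertex_subalgebra scale vac Y {s. \<forall>n\<ge>0. Y s n x = 0}"
  unfolding vertex_subalgebra_def
proof (intro conjI ballI allI)
  show "subspace {s. \<forall>n\<ge>0. Y s n x = 0}"
    by (auto simp: subspace_def Y_add_left Y_scale_left)
  show "vac \<in> {s. \<forall>n\<ge>0. Y s n x = 0}"
    by (simp add: Y_vac)
  fix u v k assume "u \<in> {s. \<forall>n\<ge>0. Y s n x = 0}" "v \<in> {s. \<forall>n\<ge>0. Y s n x = 0}"
  then show "Y u k v \<in> {s. \<forall>n\<ge>0. Y s n x = 0}"
    by (simp add: iterate)
qed

lemma generated_commuting:
  assumes "\<And>n. n \<ge> 0 \<Longrightarrow> Y a n x = 0"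
  shows "x \<in> commutant Y (generated_subalgebra scale vac Y {a})"
proof -
  have "generated_subalgebra scale vac Y {a} \<subseteq> {s. \<forall>n\<ge>0. Y s n x = 0}"
    unfolding generated_subalgebra_def using subalgebra_commuting assms by auto
  then show ?thesis by (auto simp: commutant_def)
qed

text \<open>
  This is $[x_m, L(-1)] = m\,x_{m-1}$, with $v_{-2}\mathbf 1$ in the role of $L(-1)v$.
\<close>

lemma Y_translation:
  "Y x (int m) (Y v (-2) vac) = Y (Y x (int m) v) (-2) vac + scale (of_nat m) (Y x (int m - 1) v)"
proof -
  have "Y x (int m) (Y v (-2) vac) =
      Sum_any (\<lambda>i::nat. scale (of_int (int m) gchoose i) (Y (Y x (int i) v) (int m + (-2) - int i) vac))"
    using commutator[of x "int m" v "-2" vac] by (simp add: Y_creation_nonneg)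
  also have "\<dots> = (\<Sum>i<Suc m. scale (of_nat (m choose i)) (Y (Y x (int i) v) (int m - 2 - int i) vac))"
  proof (subst Sum_any_lessThan[of "Suc m"])
    fix i assume "i \<ge> Suc m"
    then show "scale (of_int (int m) gchoose i) (Y (Y x (int i) v) (int m + (-2) - int i) vac) = 0"
      by (simp add: binomial_gbinomial[symmetric] binomial_eq_0)
  qed (simp add: binomial_gbinomial)
  also have "\<dots> = Y (Y x (int m) v) (-2) vac + scale (of_nat m) (Y x (int m - 1) v)"
  proof (cases m)
    case 0
    then show ?thesis by simp
  next
    case (Suc l)
    have "(\<Sum>i<l. scale (of_nat (m choose i)) (Y (Y x (int i) v) (int m - 2 - int i) vac)) = 0"
      by (rule sum.neutral) (auto simp: Suc Y_creation_nonneg)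
    then show ?thesis
      using Y_creation by (simp add: Suc algebra_simps)
  qed
  finally show ?thesis .
qed

text \<open>
  The hypothesis on $x$ makes $a_0$ commute with every $x_k$.  If $x_mv = 0$ with $m > 0$, then
  $0 = a_0x_mv = x_ma_0v = x_mL(-1)v = m\,x_{m-1}v$.  Since $x_kv = 0$ for large $k$, one descends to
  $k = 0$.
\<close>

lemma commuting_of_translation:
  assumes ax: "Y a 0 x = 0" and av: "Y a 0 v = Y v (-2) vac"
    and n: "n \<ge> 0"
  shows "Y x n v = 0"
proof -
  have comm: "Y a 0 (Y x k w) = Y x k (Y a 0 w)" for k w
    using commutator[of a 0 x k w]
    by (subst (asm) Sum_any_lessThan[of 1]) (auto simp: ax gbinomial_0_left)
  have step: "Y x (int m) v = 0" if "Y x (int (Suc m)) v = 0" for m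
  proof -
    have "Y x (int (Suc m)) (Y v (-2) vac) = 0"
      using comm[of "int (Suc m)" v] that by (simp add: av)
    then have "scale (of_nat (Suc m)) (Y x (int m) v) = 0"
      using Y_translation[of x "Suc m" v] that by simp
    then show ?thesis using of_nat_neq_0 scale_eq_0_iff by blast
  qed
  obtain N where N: "\<And>k. k \<ge> N \<Longrightarrow> Y x k v = 0"
    using truncation[of x v] by auto
  obtain M where M: "nat n \<le> M" "N \<le> int M"
    by (metis nat_le_linear nat_le_iff)
  have "Y x (int (nat n)) v = 0"
    using M(1) by (induction rule: inc_induct) (use N M(2) step in auto)
  then show ?thesis using n by simp
qed

end

section \<open>Chains of semi-conformal vectors\<close>

context full_vertex_algebra
begin

text \<open>
  Inside its own vertex operator algebra $\omega' = L'(-2)\mathbf 1$, so the Virasoro relations give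
  $L'(n)\omega'$.
\<close>

lemma semi_conformal_self_products:
  assumes "\<omega>' \<in> semi_conformal scale vac Y \<omega>"
  shows "Y \<omega>' 0 \<omega>' = Y \<omega>' (-2) vac" and "Y \<omega>' 1 \<omega>' = scale 2 \<omega>'"
    and "Y \<omega>' 2 \<omega>' = 0" and "\<And>n. n \<ge> 4 \<Longrightarrow> Y \<omega>' n \<omega>' = 0"
proof -
  obtain U where U: "vertex_operator_algebra scale U vac Y \<omega>'"
    using assms by (auto simp: semi_conformal_def)
  then interpret U: vertex_operator_algebra scale U vac Y \<omega>' .
  obtain c :: complex where c: "\<And>m n v. v \<in> U \<Longrightarrow>
      Y \<omega>' (m + 1) (Y \<omega>' (n + 1) v) - Y \<omega>' (n + 1) (Y \<omega>' (m + 1) v) =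
      scale (of_int (m - n)) (Y \<omega>' (m + n + 1) v)
      + (if m + n = 0 then scale (of_int (m ^ 3 - m) / 12 * c) v else 0)"
    using U.virasoro by blast
  have *: "Y \<omega>' (m + 1) \<omega>' = scale (of_int (m + 2)) (Y \<omega>' (m - 1) vac)" if "m \<ge> 0" "m \<noteq> 2" for m
    using c[OF U.vac_in, of m "-2"] that by (simp add: Y_creation Y_creation_nonneg)
  show "Y \<omega>' 0 \<omega>' = Y \<omega>' (-2) vac"
    using U.L_derivative[OF U.omega_in U.vac_in, of "-1"] by (simp add: Y_creation)
  show "Y \<omega>' 1 \<omega>' = scale 2 \<omega>'"
    using *[of 0] by (simp add: Y_creation)
  show "Y \<omega>' 2 \<omega>' = 0"
    using *[of 1] by (simp add: Y_creation_nonneg)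
  show "Y \<omega>' n \<omega>' = 0" if "n \<ge> 4" for n
    using *[of "n - 1"] that by (simp add: Y_creation_nonneg)
qed

text \<open>
  The five conditions in the definition of $\preceq$ are the equations
  $L^2(n)\omega^1 = L^1(n)\omega^1$ for $n \ge -1$, the right-hand sides having been evaluated.
\<close>

lemma sc_le_commuting:
  assumes w1: "\<omega>1 \<in> semi_conformal scale vac Y \<omega>" and le: "sc_le scale Y \<omega>1 \<omega>2"
    and n: "n \<ge> 0"
  shows "Y (\<omega>2 - \<omega>1) n \<omega>1 = 0"
proof -
  note s = semi_conformal_self_products[OF w1]
  have le': "Y \<omega>2 1 \<omega>1 = scale 2 \<omega>1" "Y \<omega>2 2 \<omega>1 = 0" "Y \<omega>2 3 \<omega>1 = Y \<omega>1 3 \<omega>1"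
      "Y \<omega>2 0 \<omega>1 = Y \<omega>1 0 \<omega>1" "\<And>k. k \<ge> 3 \<Longrightarrow> Y \<omega>2 (k + 1) \<omega>1 = 0"
    using le by (auto simp: sc_le_def Let_def)
  consider "n = 0" | "n = 1" | "n = 2" | "n = 3" | "n \<ge> 4" using n by linarith
  then show ?thesis
    by cases (use s le'(1-4) le'(5)[of "n - 1"] in \<open>simp_all add: Y_left.diff\<close>)
qed

text \<open>
  The consecutive difference commutes with $\omega^i$ by the definition of $\preceq$; the translation
  criterion with $a = \omega^i$ extends this to every $\omega^j$ for which
  $(\omega^i)_0\omega^j = L(-1)\omega^j$.  Each new commutation in turn propagates this equation from
  $\omega^i$ to $\omega^{i+1}$.
\<close>

lemma chain_commuting:
  assumes sc: "\<And>i. i \<le> d \<Longrightarrow> \<omega>s i \<in> semi_conformal scale vac Y \<omega>"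
    and chain: "\<And>i. i < d \<Longrightarrow> sc_le scale Y (\<omega>s i) (\<omega>s (Suc i))"
    and ij: "i < d" "j \<le> i" and n: "n \<ge> 0"
  shows "Y (\<omega>s (Suc i) - \<omega>s i) n (\<omega>s j) = 0"
proof -
  have commute: "Y (\<omega>s (Suc i) - \<omega>s i) n (\<omega>s j) = 0"
    if "i < d" "n \<ge> 0" "Y (\<omega>s i) 0 (\<omega>s j) = Y (\<omega>s j) (-2) vac" for i j n
  proof (rule commuting_of_translation[OF _ that(3) that(2)])
    have "Y (\<omega>s (Suc i) - \<omega>s i) n (\<omega>s i) = 0" if "n \<ge> 0" for n
      using sc[of i] chain[of i] \<open>i < d\<close> that by (intro sc_le_commuting[of _ \<omega>]) simp_all
    from commuting_sym[OF this] show "Y (\<omega>s i) 0 (\<omega>s (Suc i) - \<omega>s i) = 0"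
      by simp
  qed
  have transl: "Y (\<omega>s i) 0 (\<omega>s j) = Y (\<omega>s j) (-2) vac" if "j \<le> i" "i \<le> d" for i j
    using that
  proof (induction i rule: dec_induct)
    case base
    then show ?case by (intro semi_conformal_self_products(1)[OF sc])
  next
    case (step i)
    then have "Y (\<omega>s (Suc i) - \<omega>s i) 0 (\<omega>s j) = 0"
      by (intro commute) auto
    then show ?case using step by (simp add: Y_left.diff)
  qed
  show ?thesis using commute transl ij n by simp
qed

lemma chain_differences_commuting:
  assumes sc: "\<And>i. i \<le> d \<Longrightarrow> \<omega>s i \<in> semi_conformal scale vac Y \<omega>"
    and chain: "\<And>i. i < d \<Longrightarrow> sc_le scale Y (\<omega>s i) (\<omega>s (Suc i))"
    and ij: "i \<in> {1..d}" "j \<in> {1..d}" "i \<noteq> j" and n: "n \<ge> 0"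
  shows "Y (\<omega>s i - \<omega>s (i - 1)) n (\<omega>s j - \<omega>s (j - 1)) = 0"
proof -
  have less: "Y (\<omega>s i - \<omega>s (i - 1)) n (\<omega>s j - \<omega>s (j - 1)) = 0"
    if "j < i" "i \<in> {1..d}" "j \<in> {1..d}" "n \<ge> 0" for i j n
    using chain_commuting[of d \<omega>s \<omega>, OF sc chain, of "i - 1" j n]
      chain_commuting[of d \<omega>s \<omega>, OF sc chain, of "i - 1" "j - 1" n] that
    by (auto simp: Y_right.diff)
  show ?thesis
  proof (cases "j < i")
    case True
    then show ?thesis using less ij n by blast
  next
    case False
    show ?thesis
      by (rule commuting_sym[OF less]) (use False ij n in auto)
  qed
qed

lemma commuting_eigenvectors_independent:
  assumes "finite I"
    and e: "\<And>i j. i \<in> I \<Longrightarrow> j \<in> I \<Longrightarrow> Y (e j) 1 (x i) = (if i = j then x i else 0)"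
    and nz: "\<And>i. i \<in> I \<Longrightarrow> x i \<noteq> 0"
  shows "inj_on x I" and "independent (x ` I)"
proof -
  show inj: "inj_on x I"
    by (intro inj_onI) (metis e nz)
  show "independent (x ` I)"
  proof
    assume "dependent (x ` I)"
    then obtain u i where u: "(\<Sum>v\<in>x ` I. scale (u v) v) = 0" and i: "i \<in> I" "u (x i) \<noteq> 0"
      using dependent_finite[of "x ` I"] assms(1) by auto
    have "0 = Y (e i) 1 (\<Sum>j\<in>I. scale (u (x j)) (x j))"
      using u inj by (simp add: sum.reindex)
    also have "\<dots> = (\<Sum>j\<in>I. if j = i then scale (u (x i)) (x i) else 0)"
      unfolding Y_right.sum Y_scale_right using e i by (intro sum.cong) auto
    also have "\<dots> = scale (u (x i)) (x i)"
      using assms(1) i by simp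
    finally show False using i nz by auto
  qed
qed

text \<open>
  Both the independence and the commutation of the $x_i$ come from the double commutant: it contains
  only vectors commuting with the $e_j$, $j \ne i$, and it commutes with the vectors $x_j$, which lie
  in the single commutant of $e_i$.
\<close>

lemma commuting_independent_vectors_of_chain:
  assumes sc: "\<And>i. i \<le> d \<Longrightarrow> \<omega>s i \<in> semi_conformal scale vac Y \<omega>"
    and chain: "\<And>i. i < d \<Longrightarrow> sc_le scale Y (\<omega>s i) (\<omega>s (Suc i))"
    and first: "\<omega>s 0 = 0" and last: "\<omega>s d = \<omega>"
    and comm: "\<And>i. i \<in> {1..d} \<Longrightarrow> dim (commutant Y (commutant Y
        (generated_subalgebra scale vac Y {\<omega>s i - \<omega>s (i - 1)})) \<inter> weight_space scale UNIV Y \<omega> 1) \<noteq> 0"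
  obtains X where "finite X" "card X = d" "independent X" "X \<subseteq> weight_space scale UNIV Y \<omega> 1"
    "\<And>x y n. x \<in> X \<Longrightarrow> y \<in> X \<Longrightarrow> x \<noteq> y \<Longrightarrow> n \<ge> 0 \<Longrightarrow> Y x n y = 0"
proof -
  define e where "e i = \<omega>s i - \<omega>s (i - 1)" for i
  let ?C = "\<lambda>i. commutant Y (generated_subalgebra scale vac Y {e i})"
  have ex_x: "\<exists>x. x \<in> commutant Y (?C i) \<inter> weight_space scale UNIV Y \<omega> 1 \<and> x \<noteq> 0"
    if "i \<in> {1..d}" for i
  proof (rule ccontr)
    assume "\<not> ?thesis"
    then have "commutant Y (?C i) \<inter> weight_space scale UNIV Y \<omega> 1 \<subseteq> span {}"
      by auto
    then have "dim (commutant Y (?C i) \<inter> weight_space scale UNIV Y \<omega> 1) \<le> card ({} :: 'v set)"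
      by (rule dim_le_card) simp
    then show False using comm[OF that] by (simp add: e_def)
  qed
  define x where "x i = (SOME x. x \<in> commutant Y (?C i) \<inter> weight_space scale UNIV Y \<omega> 1 \<and> x \<noteq> 0)" for i
  have x: "x i \<in> commutant Y (?C i)" "x i \<in> weight_space scale UNIV Y \<omega> 1" "x i \<noteq> 0"
    if "i \<in> {1..d}" for i
    using someI_ex[OF ex_x[OF that]] by (simp_all add: x_def)
  have ee: "Y (e i) n (e j) = 0" if "i \<in> {1..d}" "j \<in> {1..d}" "i \<noteq> j" "n \<ge> 0" for i j n
    unfolding e_def using chain_differences_commuting[of d \<omega>s \<omega>, OF sc chain] that by blast
  have ex: "Y (e j) n (x i) = 0" if "i \<in> {1..d}" "j \<in> {1..d}" "i \<noteq> j" "n \<ge> 0" for i j n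
  proof -
    have "e j \<in> ?C i"
      by (rule generated_commuting) (use ee that in auto)
    then show ?thesis using x(1)[OF that(1)] that(4) by (auto simp: commutant_def)
  qed
  have sum_e: "(\<Sum>j=1..k. e j) = \<omega>s k" for k
    by (induction k) (simp_all add: first e_def)
  have exx: "Y (e i) 1 (x i) = x i" if "i \<in> {1..d}" for i
  proof -
    have "x i = Y \<omega> 1 (x i)"
      using x(2)[OF that] by (simp add: weight_space_def)
    also have "\<dots> = (\<Sum>j=1..d. Y (e j) 1 (x i))"
      using Y_left.sum[of e "{1..d}" 1 "x i"] by (simp only: sum_e last)
    also have "\<dots> = (\<Sum>j=1..d. if j = i then Y (e i) 1 (x i) else 0)"
      by (intro sum.cong refl) (use ex that in auto)
    also have "\<dots> = Y (e i) 1 (x i)"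
      using that by simp
    finally show ?thesis by simp
  qed
  have e1: "Y (e j) 1 (x i) = (if i = j then x i else 0)" if "i \<in> {1..d}" "j \<in> {1..d}" for i j
    using ex exx that by simp
  have xx: "Y (x i) n (x j) = 0" if "i \<in> {1..d}" "j \<in> {1..d}" "i \<noteq> j" "n \<ge> 0" for i j n
  proof -
    have "x i \<in> ?C j"
      by (rule generated_commuting) (use ex that in auto)
    then show ?thesis using x(1)[OF that(2)] that(4) by (auto simp: commutant_def)
  qed
  note ind = commuting_eigenvectors_independent[of "{1..d}" e x, OF _ e1 x(3)]
  show ?thesis
  proof
    show "finite (x ` {1..d})" by simp
    show "card (x ` {1..d}) = d" using ind(1) by (simp add: card_image)
    show "independent (x ` {1..d})" using ind(2) by simp
    show "x ` {1..d} \<subseteq> weight_space scale UNIV Y \<omega> 1" using x(2) by auto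
    fix u v n assume u: "u \<in> x ` {1..d}" and v: "v \<in> x ` {1..d}" and "u \<noteq> v" and n: "(n::int) \<ge> 0"
    obtain i where i: "i \<in> {1..d}" "u = x i" using u by (rule imageE)
    obtain j where j: "j \<in> {1..d}" "v = x j" using v by (rule imageE)
    have "i \<noteq> j" using i j \<open>u \<noteq> v\<close> by metis
    then show "Y u n v = 0" unfolding i j by (rule xx[OF i(1) j(1) _ n])
  qed
qed

end

section \<open>The weight-one space\<close>

locale cft_type_voa = full_vertex_algebra scale vac Y +
    vertex_operator_algebra scale UNIV vac Y \<omega>
  for scale :: "complex \<Rightarrow> 'v::ab_group_add \<Rightarrow> 'v" and vac :: 'v
    and Y :: "'v \<Rightarrow> int \<Rightarrow> 'v \<Rightarrow> 'v" and \<omega> :: 'v +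
  assumes vac_nonzero: "vac \<noteq> 0"
    and weight_neg: "\<And>n. n < 0 \<Longrightarrow> weight_space scale UNIV Y \<omega> n = {0}"
    and weight_zero: "weight_space scale UNIV Y \<omega> 0 = range (\<lambda>c. scale c vac)"
    and generated: "generated_subalgebra scale vac Y (weight_space scale UNIV Y \<omega> 1) = UNIV"
    and nondegenerate: "\<And>u. u \<in> weight_space scale UNIV Y \<omega> 1 \<Longrightarrow>
        (\<And>v. v \<in> weight_space scale UNIV Y \<omega> 1 \<Longrightarrow> V1_form scale vac Y u v = 0) \<Longrightarrow> u = 0"
begin

abbreviation "V1 \<equiv> weight_space scale UNIV Y \<omega> 1"

abbreviation "form \<equiv> V1_form scale vac Y"

lemma subspace_V1: "subspace V1"
  by (auto simp: subspace_def weight_space_def Y_add_right Y_scale_right scale_right_distrib)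

lemma form_eqI:
  assumes "Y u 1 v = scale c vac"
  shows "form u v = c"
  unfolding V1_form_def using assms vac_nonzero by auto

lemma form_zero [simp]: "form u 0 = 0" "form 0 v = 0"
  by (rule form_eqI; simp)+

lemma V1_L0_eq: "u \<in> V1 \<Longrightarrow> Y \<omega> 1 u = u"
  by (simp add: weight_space_def)

lemma one_gchoose_eq_0:
  assumes "2 \<le> i" shows "(1::complex) gchoose i = 0"
proof -
  have "of_nat (1 choose i) = (of_nat 1 :: complex) gchoose i"
    by (rule binomial_gbinomial)
  moreover have "1 choose i = 0" using assms by (intro binomial_eq_0) simp
  ultimately show ?thesis by (metis of_nat_0 of_nat_1)
qed

text \<open>
  $[L(0), u_n] = (L(-1)u)_{n+1} + (L(0)u)_n = -(n+1)u_n + u_n$.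
\<close>

lemma L0_commutator:
  assumes "u \<in> V1"
  shows "Y \<omega> 1 (Y u n w) = Y u n (Y \<omega> 1 w) - scale (of_int n) (Y u n w)"
proof -
  have "Y \<omega> 1 (Y u n w) - Y u n (Y \<omega> 1 w) = (\<Sum>i<2. scale (of_int 1 gchoose i) (Y (Y \<omega> (int i) u) (1 + n - int i) w))"
    unfolding commutator
  proof (rule Sum_any_lessThan)
    fix i :: nat assume "2 \<le> i"
    then have "(1::complex) gchoose i = 0"
      using one_gchoose_eq_0 by simp
    then show "scale (of_int 1 gchoose i) (Y (Y \<omega> (int i) u) (1 + n - int i) w) = 0"
      by simp
  qed
  also have "\<dots> = Y (Y \<omega> 0 u) (1 + n) w + Y u n w"
    using V1_L0_eq[OF assms] by (simp add: numeral_2_eq_2)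
  also have "Y (Y \<omega> 0 u) (1 + n) w = scale (- of_int (1 + n)) (Y u n w)"
    using L_derivative[of u w "1 + n"] by simp
  finally show ?thesis
    by (simp add: algebra_simps scale_left_distrib scale_left_diff_distrib)
qed

lemma weight_Y:
  assumes "u \<in> V1" "v \<in> weight_space scale UNIV Y \<omega> k"
  shows "Y u n v \<in> weight_space scale UNIV Y \<omega> (k - n)"
  using assms L0_commutator[OF assms(1), of n v]
  by (simp add: weight_space_def Y_scale_right scale_left_diff_distrib)

text \<open>
  $u_1v$ has weight zero, which is what makes the definite description in the form meaningful.
\<close>

lemma Y_V1_form:
  assumes "u \<in> V1" "v \<in> V1"
  shows "Y u 1 v = scale (form u v) vac"
proof -
  have "Y u 1 v \<in> range (\<lambda>c. scale c vac)"
    using weight_Y[OF assms, of 1] weight_zero by simp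
  then obtain c where c: "Y u 1 v = scale c vac" by blast
  show ?thesis unfolding form_eqI[OF c] by (rule c)
qed

lemma Y_V1_ge2:
  assumes "u \<in> V1" "v \<in> V1" "n \<ge> 2"
  shows "Y u n v = 0"
  using weight_Y[OF assms(1,2), of n] weight_neg[of "1 - n"] assms(3) by simp

lemma form_scale:
  assumes "u \<in> V1" "w \<in> V1"
  shows "form (scale c u) w = c * form u w" "form w (scale c u) = c * form w u"
  by (rule form_eqI; simp add: assms Y_V1_form Y_scale_left Y_scale_right)+

lemma form_sum_right:
  assumes "u \<in> V1" "\<And>i. i \<in> I \<Longrightarrow> v i \<in> V1"
  shows "form u (\<Sum>i\<in>I. scale (c i) (v i)) = (\<Sum>i\<in>I. c i * form u (v i))"
  by (rule form_eqI) (use assms in \<open>simp add: Y_right.sum Y_scale_right Y_V1_form scale_sum_left\<close>)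

text \<open>
  Skew-symmetry reads $u_0u = -u_0u + L(-1)(u_1u)$, and $u_1u$ is a multiple of the vacuum.
\<close>

lemma bracket_self:
  assumes "u \<in> V1"
  shows "Y u 0 u = 0"
proof -
  have "Y u 0 u = - Sum_any (\<lambda>i::nat. scale ((-1) ^ i) (Y (Y u (int i) u) (- 1 - int i) vac))"
    using skew_symmetry[of u 0 u] by simp
  also have "Sum_any (\<lambda>i::nat. scale ((-1) ^ i) (Y (Y u (int i) u) (- 1 - int i) vac)) =
      (\<Sum>i<2. scale ((-1) ^ i) (Y (Y u (int i) u) (- 1 - int i) vac))"
    using Y_V1_ge2 assms by (intro Sum_any_lessThan) auto
  also have "\<dots> = Y u 0 u"
    by (simp add: numeral_2_eq_2 Y_V1_form assms Y_vac_scale Y_creation)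
  finally have "Y u 0 u + Y u 0 u = 0"
    by (simp add: eq_neg_iff_add_eq_0)
  then have "scale 2 (Y u 0 u) = 0"
    using scale_left_distrib[of 1 1 "Y u 0 u"] by simp
  then show ?thesis by simp
qed

lemma V1_finite_dim: obtains B where "finite B" "V1 \<subseteq> span B"
  using weight_space_finite_dim by blast

text \<open>
  The ambient space need not be finite dimensional, so the exchange argument has to be run inside a finite
  spanning set of $V_1$.
\<close>

lemma V1_span_of_card:
  assumes "independent X" "X \<subseteq> V1" "card X = dim V1" "finite X"
  shows "span X = V1"
proof
  show "span X \<subseteq> V1" using assms(2) subspace_V1 by (rule span_minimal)
  obtain B where B: "B \<subseteq> V1" "independent B" "V1 \<subseteq> span B" "card B = dim V1"
    using basis_exists by blast
  obtain B' where B': "finite B'" "V1 \<subseteq> span B'"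
    using V1_finite_dim by blast
  have "finite B" using independent_span_bound[OF B'(1) B(2)] B(1) B'(2) by auto
  show "V1 \<subseteq> span X"
  proof
    fix v assume v: "v \<in> V1"
    show "v \<in> span X"
    proof (rule ccontr)
      assume nv: "v \<notin> span X"
      then have "independent (insert v X)" using assms(1) independent_insertI by blast
      then have "card (insert v X) \<le> card B"
        using independent_span_bound[OF \<open>finite B\<close>, of "insert v X"] v assms(2) B(3) by auto
      moreover have "card (insert v X) = Suc (card X)"
        using nv span_base assms(4) by (intro card_insert_disjoint) auto
      ultimately show False using B(4) assms(3) by simp
    qed
  qed
qed

lemma Y_bracket_zero_of_basis:
  assumes X: "X \<subseteq> V1" "span X = V1"
    and comm: "\<And>x y n. x \<in> X \<Longrightarrow> y \<in> X \<Longrightarrow> x \<noteq> y \<Longrightarrow> n \<ge> 0 \<Longrightarrow> Y x n y = 0"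
    and uv: "u \<in> V1" "v \<in> V1"
  shows "Y u 0 v = 0"
proof -
  have *: "Y x 0 y = 0" if "x \<in> X" "y \<in> X" for x y
    using comm[of x y 0] bracket_self that X by (cases "x = y") auto
  have **: "Y x 0 v = 0" if "x \<in> X" for x
    using Y_right.eq_0_on_span[of X x 0 v] * that X(2) uv(2) by auto
  show ?thesis
    using Y_left.eq_0_on_span[of X 0 v u] ** X(2) uv(1) by auto
qed

text \<open>
  Distinct members of the basis are orthogonal, so an isotropic one would be orthogonal to all of
  $V_1$.  Square roots for the normalisation exist over the complex numbers.
\<close>

lemma orthonormal_basis_of_commuting_basis:
  assumes X: "finite X" "X \<subseteq> V1" "span X = V1"
    and comm: "\<And>x y n. x \<in> X \<Longrightarrow> y \<in> X \<Longrightarrow> x \<noteq> y \<Longrightarrow> n \<ge> 0 \<Longrightarrow> Y x n y = 0"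
    and indep: "independent X"
  obtains B where "heisenberg.orthonormal_basis scale V1 form B"
proof -
  have orth: "form x y = 0" if "x \<in> X" "y \<in> X" "x \<noteq> y" for x y
    by (rule form_eqI) (use comm that in auto)
  have norm: "form x x \<noteq> 0" if "x \<in> X" for x
  proof
    assume 0: "form x x = 0"
    have "x = 0"
    proof (rule nondegenerate)
      show "x \<in> V1" using that X by auto
      fix v assume "v \<in> V1"
      then have "v \<in> span X" using X by simp
      moreover have "Y x 1 y = 0" if "y \<in> X" for y
        using Y_V1_form[of x y] orth[of x y] 0 X that \<open>x \<in> X\<close> by (cases "x = y") auto
      ultimately have "Y x 1 v = 0"
        using Y_right.eq_0_on_span[of X x 1 v] by auto
      then show "form x v = 0" by (intro form_eqI) simp
    qed
    then show False using that indep dependent_zero by auto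
  qed
  define r where "r x = inverse (csqrt (form x x))" for x
  have r0: "r x \<noteq> 0" if "x \<in> X" for x
    using norm[OF that] by (simp add: r_def)
  have rr: "r x * r x * form x x = 1" if "x \<in> X" for x
  proof -
    have "r x * r x = inverse (form x x)"
      using power2_csqrt[of "form x x"] by (simp add: r_def power2_eq_square flip: inverse_mult_distrib)
    then show ?thesis using norm[OF that] by simp
  qed
  let ?b = "\<lambda>x. scale (r x) x"
  have bb: "form (?b x) (?b y) = (if x = y then 1 else 0)" if "x \<in> X" "y \<in> X" for x y
  proof -
    have "x \<in> V1" "y \<in> V1" using that X by auto
    then have "form (?b x) (?b y) = r x * r y * form x y"
      using form_scale(1)[of x "?b y" "r x"] form_scale(2)[of y x "r y"]
        subspace_scale[OF subspace_V1] by simp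
    then show ?thesis using rr orth that by auto
  qed
  have "heisenberg.orthonormal_basis scale V1 form (?b ` X)"
    unfolding heisenberg.orthonormal_basis_def
  proof (intro conjI ballI)
    show "finite (?b ` X)" using X by simp
    show "?b ` X \<subseteq> V1" using X subspace_scale[OF subspace_V1] by auto
    have "X \<subseteq> span (?b ` X)"
    proof
      fix x assume "x \<in> X"
      then have "scale (inverse (r x)) (?b x) \<in> span (?b ` X)"
        by (intro span_scale span_base) auto
      then show "x \<in> span (?b ` X)" using r0[OF \<open>x \<in> X\<close>] by simp
    qed
    then show "span (?b ` X) = V1"
      using X(3) \<open>?b ` X \<subseteq> V1\<close> subspace_V1
      by (intro equalityI span_minimal) (metis span_minimal subspace_span)+
    fix u v assume "u \<in> ?b ` X" "v \<in> ?b ` X"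
    then obtain x y where xy: "x \<in> X" "y \<in> X" "u = ?b x" "v = ?b y" by auto
    show "form u v = (if u = v then 1 else 0)"
    proof (cases "x = y")
      case True
      then show ?thesis using bb xy by simp
    next
      case False
      then have "?b x \<noteq> ?b y" using bb[OF xy(1,1)] bb[OF xy(1,2)] by auto
      then show ?thesis using False bb xy by simp
    qed
  qed
  then show ?thesis using that by blast
qed

text \<open>
  Only $u_1v$ contributes to the commutator formula: $u_0v$ vanishes by hypothesis and $u_iv$ has
  negative weight for $i \ge 2$.
\<close>

lemma heisenberg_relation:
  assumes uv: "u \<in> V1" "v \<in> V1" and ab: "Y u 0 v = 0"
  shows "Y u m (Y v n w) - Y v n (Y u m w) = (if m + n = 0 then scale (of_int m * form u v) w else 0)"
proof -
  have "Y u m (Y v n w) - Y v n (Y u m w) =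
      (\<Sum>i<2. scale (of_int m gchoose i) (Y (Y u (int i) v) (m + n - int i) w))"
    unfolding commutator using Y_V1_ge2 uv by (intro Sum_any_lessThan) auto
  then show ?thesis
    by (simp add: numeral_2_eq_2 ab Y_V1_form uv Y_vac_scale)
qed

text \<open>
  The vectors all of whose modes preserve $S$ form a vertex subalgebra, by the iterate formula; it
  contains $V_1$, hence is everything, and $v = v_{-1}\mathbf 1$.
\<close>

lemma subspace_eq_UNIV_of_V1_modes:
  assumes S: "subspace S" "vac \<in> S" and modes: "\<And>u n w. u \<in> V1 \<Longrightarrow> w \<in> S \<Longrightarrow> Y u n w \<in> S"
  shows "S = UNIV"
proof -
  let ?U = "{v. \<forall>n. \<forall>w\<in>S. Y v n w \<in> S}"
  have "vertex_subalgebra scale vac Y ?U"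
    unfolding vertex_subalgebra_def
  proof (intro conjI ballI allI)
    show "subspace ?U"
      using S(1) by (auto simp: subspace_def Y_add_left Y_scale_left)
    show "vac \<in> ?U" using S(1) by (auto simp: Y_vac subspace_0)
    fix u v k assume uv: "u \<in> ?U" "v \<in> ?U"
    have "Y (Y u k v) n w \<in> S" if "w \<in> S" for n w
      unfolding iterate using uv that
      by (intro Sum_any_mem_subspace[OF S(1)] subspace_scale[OF S(1)] subspace_diff[OF S(1)]) auto
    then show "Y u k v \<in> ?U" by blast
  qed
  moreover have "V1 \<subseteq> ?U" using modes by auto
  ultimately have "generated_subalgebra scale vac Y V1 \<subseteq> ?U"
    unfolding generated_subalgebra_def by blast
  then have "UNIV \<subseteq> ?U" unfolding generated .
  then have "Y v (-1) vac \<in> S" for v using S(2) by blast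
  then show ?thesis by (auto simp: Y_creation)
qed

text \<open>
  Skew-symmetry reduces $u_n\omega$ to $L(k)u$ with $k \ge n-1$.  Here $L(0)u = u$, $L(1)u$ is a
  multiple of the vacuum, possibly nonzero, and $L(k)u = 0$ for $k \ge 2$ by weight.
\<close>

lemma V1_modes_omega:
  assumes u: "u \<in> V1"
  obtains c where "Y u 1 \<omega> = u" "Y u 2 \<omega> = scale c vac" "\<And>n. n \<ge> 3 \<Longrightarrow> Y u n \<omega> = 0"
proof -
  obtain c where c: "\<And>m n v. 
      Y \<omega> (m + 1) (Y \<omega> (n + 1) v) - Y \<omega> (n + 1) (Y \<omega> (m + 1) v) =
      scale (of_int (m - n)) (Y \<omega> (m + n + 1) v)
      + (if m + n = 0 then scale (of_int (m ^ 3 - m) / 12 * c) v else 0)"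
    using virasoro by blast
  have wt: "Y \<omega> (n + 1) u \<in> weight_space scale UNIV Y \<omega> (1 - n)" if "n \<noteq> 0" for n
    using c[of 0 n u] V1_L0_eq[OF u] that
    by (simp add: weight_space_def scale_left_diff_distrib algebra_simps)
  have w3: "Y \<omega> n u = 0" if "n \<ge> 3" for n
    using wt[of "n - 1"] weight_neg[of "2 - n"] that by simp
  have "Y \<omega> 2 u \<in> range (\<lambda>c. scale c vac)"
    using wt[of 1] weight_zero by simp
  then obtain l where l: "Y \<omega> 2 u = scale l vac" by blast
  have skew: "Y u n \<omega> = - scale ((-1) powi n) (\<Sum>i<nat (3 - n). scale ((-1) ^ i) (Y (Y \<omega> (n + int i) u) (- 1 - int i) vac))" for n
    by (subst skew_symmetry, subst Sum_any_lessThan[of "nat (3 - n)"]) (auto simp: w3)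
  show ?thesis
  proof
    show "Y u 1 \<omega> = u"
      using skew[of 1] V1_L0_eq[OF u] l by (simp add: numeral_2_eq_2 Y_creation Y_vac_scale)
    show "Y u 2 \<omega> = scale (- l) vac"
      using skew[of 2] l by (simp add: Y_creation)
    show "Y u n \<omega> = 0" if "n \<ge> 3" for n
      using skew[of n] that by simp
  qed
qed

lemma L0_omega: "Y \<omega> 1 \<omega> = scale 2 \<omega>"
proof -
  obtain c where "\<And>m n v. 
      Y \<omega> (m + 1) (Y \<omega> (n + 1) v) - Y \<omega> (n + 1) (Y \<omega> (m + 1) v) =
      scale (of_int (m - n)) (Y \<omega> (m + n + 1) v)
      + (if m + n = 0 then scale (of_int (m ^ 3 - m) / 12 * c) v else 0)"
    using virasoro by blast
  from this[of 0 "-2" vac] show ?thesis by (simp add: Y_creation Y_creation_nonneg)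
qed

end

section \<open>Irreducibility of Heisenberg modules with a vacuum\<close>

lemma linear_mem_span:
  assumes "Vector_Spaces.linear s1 s2 f" "module.subspace s2 S" "\<And>x. x \<in> X \<Longrightarrow> f x \<in> S"
    and "y \<in> module.span s1 X"
  shows "f y \<in> S"
proof -
  interpret f: Vector_Spaces.linear s1 s2 f by fact
  have "f ` f.vs1.span X \<subseteq> S"
    unfolding f.span_image[symmetric] using assms(2,3) by (intro f.vs2.span_minimal) auto
  then show ?thesis using assms(4) by auto
qed

text \<open>
  Abstract form of a Heisenberg module of level one with a vacuum, described by the modes of an
  orthonormal basis.  The relations are required on \<open>M\<close> only, since the induced module is
  a subset of a larger type.  Both $V$ and the induced module are instances.
\<close>

locale heisenberg_module = vector_space scale
  for scale :: "complex \<Rightarrow> 'm::ab_group_add \<Rightarrow> 'm" +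
  fixes M :: "'m set" and B :: "'b set" and A :: "'b \<Rightarrow> int \<Rightarrow> 'm \<Rightarrow> 'm" and v0 :: 'm
  assumes subspace_M: "subspace M" and v0_M: "v0 \<in> M" and finite_B: "finite B"
    and linear_A: "\<And>b n. b \<in> B \<Longrightarrow> Vector_Spaces.linear scale scale (A b n)"
    and A_M: "\<And>b n w. b \<in> B \<Longrightarrow> w \<in> M \<Longrightarrow> A b n w \<in> M"
    and A_commutator: "\<And>b b' m n w. b \<in> B \<Longrightarrow> b' \<in> B \<Longrightarrow> w \<in> M \<Longrightarrow>
      A b m (A b' n w) - A b' n (A b m w) = (if b = b' \<and> m + n = 0 then scale (of_int m) w else 0)"
    and A_v0: "\<And>b n. b \<in> B \<Longrightarrow> n \<ge> 0 \<Longrightarrow> A b n v0 = 0"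
    and cyclic: "\<And>S. subspace S \<Longrightarrow> v0 \<in> S \<Longrightarrow>
      (\<And>b n w. b \<in> B \<Longrightarrow> w \<in> S \<Longrightarrow> A b n w \<in> S) \<Longrightarrow> M \<subseteq> S"
begin

text \<open>
  The index is the degree $n_1 + \dots + n_r$ of $b_1(-n_1)\cdots b_r(-n_r)v_0$.
\<close>

inductive monomial :: "nat \<Rightarrow> 'm \<Rightarrow> bool" where
  vacuum: "monomial 0 v0"
| create: "monomial k w \<Longrightarrow> b \<in> B \<Longrightarrow> n > 0 \<Longrightarrow> monomial (k + n) (A b (- int n) w)"

definition filt :: "nat \<Rightarrow> 'm set"
  where "filt N = span {w. \<exists>k\<le>N. monomial k w}"

text \<open>
  The truncation at \<open>N\<close> keeps the sum finite; on vectors of degree at most \<open>N\<close> it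
  agrees with the full operator.
\<close>

definition energy :: "nat \<Rightarrow> 'm \<Rightarrow> 'm"
  where "energy N w = (\<Sum>b\<in>B. \<Sum>n=1..N. A b (- int n) (A b (int n) w))"

lemma A_zero [simp]: "b \<in> B \<Longrightarrow> A b n 0 = 0"
  and A_add: "b \<in> B \<Longrightarrow> A b n (x + y) = A b n x + A b n y"
  and A_scale: "b \<in> B \<Longrightarrow> A b n (scale c x) = scale c (A b n x)"
proof -
  assume "b \<in> B"
  then interpret A: Vector_Spaces.linear scale scale "A b n" by (rule linear_A)
  show "A b n 0 = 0" "A b n (x + y) = A b n x + A b n y" "A b n (scale c x) = scale c (A b n x)"
    by (rule A.zero A.add A.scale)+
qed

lemma A_swap:
  assumes "b \<in> B" "b' \<in> B" "w \<in> M"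
  shows "A b m (A b' n w) = A b' n (A b m w) + (if b = b' \<and> m + n = 0 then scale (of_int m) w else 0)"
  using A_commutator[OF assms, of m n] by (simp add: algebra_simps)

lemma monomial_M: "monomial k w \<Longrightarrow> w \<in> M"
  by (induction rule: monomial.induct) (auto intro: v0_M A_M)

lemma zero_mode_monomial:
  assumes "monomial k w" "b \<in> B" shows "A b 0 w = 0"
  using assms
proof (induction rule: monomial.induct)
  case vacuum
  then show ?case by (simp add: A_v0)
next
  case (create k w b' n)
  then show ?case using A_swap[OF \<open>b \<in> B\<close> \<open>b' \<in> B\<close> monomial_M, of k w 0 "- int n"] by simp
qed

text \<open>
  The spanning set is empty for $n > k$, in which case the monomial is annihilated.
\<close>

lemma annihilate_monomial:
  assumes "monomial k w" "b \<in> B" "n > 0"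
  shows "A b (int n) w \<in> span {w. \<exists>j. j + n = k \<and> monomial j w}"
  using assms
proof (induction rule: monomial.induct)
  case vacuum
  then show ?case by (simp add: A_v0 span_zero)
next
  case (create k w b' m)
  let ?S = "span {w. \<exists>j. j + n = k + m \<and> monomial j w}"
  have "A b' (- int m) (A b (int n) w) \<in> ?S"
  proof (rule linear_mem_span[OF linear_A subspace_span _ create.IH])
    show "b' \<in> B" "b \<in> B" "n > 0" by fact+
    fix x assume "x \<in> {w. \<exists>j. j + n = k \<and> monomial j w}"
    then obtain j where "j + n = k" "monomial j x" by auto
    then show "A b' (- int m) x \<in> ?S"
      using create.hyps monomial.create[of j x b' m] by (intro span_base) auto
  qed
  moreover have "(if b = b' \<and> int n + - int m = 0 then scale (of_int (int n)) w else 0) \<in> ?S"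
  proof (cases "n = m")
    case True
    have "w \<in> ?S" using create.hyps(1) True by (intro span_base) auto
    then have "scale (of_int (int n)) w \<in> ?S" by (rule span_scale)
    then show ?thesis by (auto simp only: span_zero split: if_split)
  qed (simp add: span_zero)
  ultimately show ?case
    unfolding A_swap[OF \<open>b \<in> B\<close> \<open>b' \<in> B\<close> monomial_M[OF create.hyps(1)]] by (rule span_add)
qed

lemma filt_mono: "m \<le> n \<Longrightarrow> filt m \<subseteq> filt n"
  unfolding filt_def by (rule span_mono) (auto intro: le_trans)

lemma monomial_filt: "monomial k w \<Longrightarrow> k \<le> N \<Longrightarrow> w \<in> filt N"
  unfolding filt_def by (rule span_base) auto

lemma subspace_filt: "subspace (filt N)"
  by (simp add: filt_def)

lemma A_filt:
  assumes "y \<in> filt N" "b \<in> B"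
  shows "A b n y \<in> filt (nat (int N - n))"
proof (rule linear_mem_span[OF linear_A[OF assms(2)] subspace_filt])
  show "y \<in> span {w. \<exists>k\<le>N. monomial k w}" using assms(1) by (simp add: filt_def)
  fix w assume "w \<in> {w. \<exists>k\<le>N. monomial k w}"
  then obtain k where k: "k \<le> N" "monomial k w" by blast
  consider "n = 0" | "n > 0" | "n < 0" by linarith
  then show "A b n w \<in> filt (nat (int N - n))"
  proof cases
    case 1
    then show ?thesis using zero_mode_monomial[OF k(2) assms(2)] subspace_0[OF subspace_filt] by simp
  next
    case 2
    have "A b (int (nat n)) w \<in> span {w. \<exists>j. j + nat n = k \<and> monomial j w}"
      by (rule annihilate_monomial[OF k(2) assms(2)]) (use 2 in simp)
    moreover have "j \<le> nat (int N - n)" if "j + nat n = k" for j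
      using that k(1) 2 by linarith
    then have "span {w. \<exists>j. j + nat n = k \<and> monomial j w} \<subseteq> filt (nat (int N - n))"
      unfolding filt_def by (intro span_mono) blast
    ultimately show ?thesis using 2 by auto
  next
    case 3
    then show ?thesis
      using monomial.create[OF k(2) assms(2), of "nat (- n)"] k(1) by (intro monomial_filt) auto
  qed
qed

text \<open>
  The union of the filtration is a subspace that contains the vacuum and is stable under all modes.
\<close>

lemma M_filt: "y \<in> M \<Longrightarrow> \<exists>N. y \<in> filt N"
proof -
  have "M \<subseteq> (\<Union>N. filt N)"
  proof (rule cyclic)
    show "subspace (\<Union>N. filt N)"
      unfolding subspace_def
    proof (intro conjI ballI allI)
      show "0 \<in> (\<Union>N. filt N)" using subspace_0[OF subspace_filt] by auto
      fix x y assume "x \<in> (\<Union>N. filt N)" "y \<in> (\<Union>N. filt N)"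
      then obtain a b where "x \<in> filt a" "y \<in> filt b" by auto
      then have "x \<in> filt (max a b)" "y \<in> filt (max a b)"
        using filt_mono[of a "max a b"] filt_mono[of b "max a b"] by auto
      then show "x + y \<in> (\<Union>N. filt N)" using subspace_add[OF subspace_filt] by blast
    next
      fix c x assume "x \<in> (\<Union>N. filt N)"
      then show "scale c x \<in> (\<Union>N. filt N)" using subspace_scale[OF subspace_filt] by blast
    qed
    show "v0 \<in> (\<Union>N. filt N)" using monomial_filt[OF vacuum] by blast
    show "A b n w \<in> (\<Union>N. filt N)" if "b \<in> B" "w \<in> (\<Union>N. filt N)" for b n w
      using A_filt that by blast
  qed
  then show "y \<in> M \<Longrightarrow> \<exists>N. y \<in> filt N" by auto
qed

lemma linear_energy: "Vector_Spaces.linear scale scale (energy N)"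
proof unfold_locales
  show "energy N (x + y) = energy N x + energy N y" for x y
    unfolding energy_def sum.distrib[symmetric] by (intro sum.cong refl) (simp add: A_add)
  show "energy N (scale c x) = scale c (energy N x)" for c x
    unfolding energy_def scale_sum_right by (intro sum.cong refl) (simp add: A_scale)
qed

text \<open>
  $[\sum_{b',n} b'(-n)b'(n),\, b(-m)] = m\,b(-m)$ when $m \le N$.
\<close>

lemma energy_monomial:
  assumes "monomial k w" "k \<le> N"
  shows "energy N w = scale (of_nat k) w"
  using assms
proof (induction rule: monomial.induct)
  case vacuum
  then show ?case by (simp add: energy_def A_v0)
next
  case (create k w b m)
  note w = monomial_M[OF create.hyps(1)]
  have lin: "Vector_Spaces.linear scale scale (A b (- int m))" using create by (intro linear_A)
  then interpret b: Vector_Spaces.linear scale scale "A b (- int m)" .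
  have term_eq: "A b' (- int n) (A b' (int n) (A b (- int m) w)) =
      A b (- int m) (A b' (- int n) (A b' (int n) w)) +
      (if b' = b \<and> n = m then scale (of_nat m) (A b (- int m) w) else 0)" if "b' \<in> B" "n \<in> {1..N}" for b' n
    using that create.hyps w by (auto simp: A_swap[of b' b] A_add A_scale A_M)
  have "energy N (A b (- int m) w) = A b (- int m) (energy N w) +
      (\<Sum>b'\<in>B. \<Sum>n=1..N. if b' = b \<and> n = m then scale (of_nat m) (A b (- int m) w) else 0)"
    unfolding energy_def b.sum sum.distrib[symmetric]
    by (rule sum.cong[OF refl], rule sum.cong[OF refl], rule term_eq)
  also have "(\<Sum>b'\<in>B. \<Sum>n=1..N. if b' = b \<and> n = m then scale (of_nat m) (A b (- int m) w) else 0) =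
      (\<Sum>b'\<in>B. if b' = b then scale (of_nat m) (A b (- int m) w) else 0)"
    by (intro sum.cong refl) (use create in auto)
  also have "\<dots> = scale (of_nat m) (A b (- int m) w)"
    using create finite_B by simp
  finally show ?case
    using create by (simp add: b.scale scale_left_distrib)
qed

text \<open>
  The energy operator has eigenvalue $N+1$ on the top degree, so this difference drops it.
\<close>

lemma energy_filt:
  assumes "y \<in> filt (Suc N)"
  shows "energy (Suc N) y - scale (of_nat (Suc N)) y \<in> filt N"
proof (rule linear_mem_span[OF _ subspace_filt,
      where f = "\<lambda>y. energy (Suc N) y - scale (of_nat (Suc N)) y"])
  interpret e: Vector_Spaces.linear scale scale "energy (Suc N)" by (rule linear_energy)
  show "Vector_Spaces.linear scale scale (\<lambda>y. energy (Suc N) y - scale (of_nat (Suc N)) y)"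
    by unfold_locales (simp_all add: e.add e.scale scale_right_distrib scale_right_diff_distrib mult.commute)
  show "y \<in> span {w. \<exists>k\<le>Suc N. monomial k w}" using assms by (simp add: filt_def)
  fix w assume "w \<in> {w. \<exists>k\<le>Suc N. monomial k w}"
  then obtain k where k: "k \<le> Suc N" "monomial k w" by blast
  have "energy (Suc N) w = scale (of_nat k) w" using energy_monomial k by blast
  then show "energy (Suc N) w - scale (of_nat (Suc N)) w \<in> filt N"
    using k monomial_filt[of k w N] subspace_0[OF subspace_filt]
      subspace_scale[OF subspace_filt] subspace_diff[OF subspace_filt]
    by (cases "k = Suc N") auto
qed

text \<open>
  Such a vector has energy $0$, so by the previous lemma it can be pushed down the filtration to
  degree $0$.
\<close>

lemma singular_vector:
  assumes "y \<in> M" and "\<And>b n. b \<in> B \<Longrightarrow> n > 0 \<Longrightarrow> A b n y = 0"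
  shows "\<exists>c. y = scale c v0"
proof -
  have "\<exists>c. y = scale c v0" if "y \<in> filt N" for N
    using that
  proof (induction N)
    case 0
    have "{w. \<exists>k\<le>0. monomial k w} \<subseteq> {v0}"
      by (auto elim: monomial.cases)
    from span_mono[OF this] show ?case
      using 0 by (auto simp: filt_def span_singleton)
  next
    case (Suc N)
    have "energy (Suc N) y = 0"
      unfolding energy_def by (intro sum.neutral ballI) (use assms in simp)
    then have "- scale (of_nat (Suc N)) y \<in> filt N"
      using energy_filt[OF Suc.prems] by simp
    then have "scale (- inverse (of_nat (Suc N))) (- scale (of_nat (Suc N)) y) \<in> filt N"
      by (rule subspace_scale[OF subspace_filt])
    moreover have "scale (- inverse (of_nat (Suc N))) (- scale (of_nat (Suc N)) y) = y"
      by (simp del: of_nat_Suc)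
    ultimately show ?case using Suc.IH by simp
  qed
  then show ?thesis using M_filt[OF assms(1)] by blast
qed

text \<open>
  Applying annihilation operators lowers the degree, so by induction all of them kill $y$; then $y$ is
  a multiple of the vacuum, and only the zero multiple lies in $K$.
\<close>

lemma irreducible:
  assumes K: "subspace K" "v0 \<notin> K"
    and inv: "\<And>b n w. b \<in> B \<Longrightarrow> w \<in> M \<Longrightarrow> w \<in> K \<Longrightarrow> n > 0 \<Longrightarrow> A b n w \<in> K"
    and y: "y \<in> M" "y \<in> K"
  shows "y = 0"
proof -
  have scalar: "c = 0" if "scale c v0 \<in> K" for c
    using subspace_scale[OF K(1) that, of "inverse c"] K(2) by (cases "c = 0") auto
  have zero: "y = 0" if "y \<in> M" "y \<in> K" "\<And>b n. b \<in> B \<Longrightarrow> n > 0 \<Longrightarrow> A b n y = 0" for y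
    using singular_vector[OF that(1,3)] scalar that(2) by auto
  have "y = 0" if "y \<in> filt N" "y \<in> M" "y \<in> K" for N y
    using that
  proof (induction N arbitrary: y rule: less_induct)
    case (less N)
    show ?case
    proof (rule zero[OF less.prems(2,3)])
      fix b n assume b: "b \<in> B" and n: "(n::int) > 0"
      show "A b n y = 0"
      proof (cases "N = 0")
        case True
        have "{w. \<exists>k\<le>0. monomial k w} \<subseteq> {v0}"
          by (auto elim: monomial.cases)
        from span_mono[OF this] have "y \<in> range (\<lambda>c. scale c v0)"
          using less.prems(1) True by (auto simp: filt_def span_singleton)
        then show ?thesis using b n by (auto simp: A_scale A_v0)
      next
        case False
        show ?thesis
        proof (rule less.IH)
          show "nat (int N - n) < N" using n False by linarith
          show "A b n y \<in> filt (nat (int N - n))" by (rule A_filt[OF less.prems(1) b])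
          show "A b n y \<in> M" "A b n y \<in> K" using A_M inv b n less.prems by blast+
        qed
      qed
    qed
  qed
  then show ?thesis using M_filt[OF y(1)] y by blast
qed

end

section \<open>Free vector spaces and free algebras\<close>

interpretation fs: vector_space fscale
  by (rule vector_space_fscale)

text \<open>
  The linear map on the free vector space with prescribed values on the basis.
\<close>

definition lin_ext :: "(complex \<Rightarrow> 'm::ab_group_add \<Rightarrow> 'm) \<Rightarrow> ('k \<Rightarrow> 'm) \<Rightarrow> ('k \<Rightarrow>\<^sub>0 complex) \<Rightarrow> 'm"
  where "lin_ext sc g a = (\<Sum>k\<in>Poly_Mapping.keys a. sc (Poly_Mapping.lookup a k) (g k))"

lemma lin_ext_superset:
  assumes "vector_space sc" "finite S" "Poly_Mapping.keys a \<subseteq> S"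
  shows "lin_ext sc g a = (\<Sum>k\<in>S. sc (Poly_Mapping.lookup a k) (g k))"
proof -
  interpret vector_space sc by fact
  show ?thesis
    unfolding lin_ext_def using assms(2,3)
    by (intro sum.mono_neutral_left) (auto simp: in_keys_iff)
qed

lemma linear_lin_ext:
  assumes "vector_space sc"
  shows "Vector_Spaces.linear fscale sc (lin_ext sc g)"
proof -
  interpret vector_space sc by fact
  show ?thesis
  proof unfold_locales
    fix x y :: "'b \<Rightarrow>\<^sub>0 complex"
    let ?S = "Poly_Mapping.keys x \<union> Poly_Mapping.keys y"
    have "Poly_Mapping.keys (x + y) \<subseteq> ?S" by (rule keys_add)
    then show "lin_ext sc g (x + y) = lin_ext sc g x + lin_ext sc g y"
      by (simp add: lin_ext_superset[OF assms, of ?S] lookup_add scale_left_distrib sum.distrib)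
  next
    fix c and x :: "'b \<Rightarrow>\<^sub>0 complex"
    have "Poly_Mapping.keys (fscale c x) \<subseteq> Poly_Mapping.keys x"
      by (auto simp: in_keys_iff)
    then show "lin_ext sc g (fscale c x) = sc c (lin_ext sc g x)"
      by (simp add: lin_ext_superset[OF assms, of "Poly_Mapping.keys x"] scale_sum_right)
  qed
qed

lemma lin_ext_single:
  assumes "vector_space sc"
  shows "lin_ext sc g (Poly_Mapping.single k c) = sc c (g k)"
proof -
  interpret vector_space sc by fact
  show ?thesis by (simp add: lin_ext_superset[OF assms, of "{k}"])
qed

lemma fscale_single: "fscale c (Poly_Mapping.single k d) = Poly_Mapping.single k (c * d)"
  by (rule poly_mapping_eqI) (simp add: lookup_single when_def)

lemma single_eq_fscale: "Poly_Mapping.single k c = fscale c (Poly_Mapping.single k 1)"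
  by (simp add: fscale_single)

lemma lin_ext_singles: "lin_ext fscale (\<lambda>k. Poly_Mapping.single k 1) a = a"
  unfolding lin_ext_def
  by (rule poly_mapping_eqI)
    (simp add: lookup_sum lookup_single when_def in_keys_iff if_distrib[of "(*) _"] cong: if_cong)

lemma span_singles:
  assumes "Poly_Mapping.keys a \<subseteq> K"
  shows "a \<in> fs.span ((\<lambda>k. Poly_Mapping.single k 1) ` K)"
proof -
  have "lin_ext fscale (\<lambda>k. Poly_Mapping.single k 1) a \<in> fs.span ((\<lambda>k. Poly_Mapping.single k 1) ` K)"
    unfolding lin_ext_def using assms by (intro fs.span_sum fs.span_scale fs.span_base) auto
  then show ?thesis by (simp add: lin_ext_singles)
qed

lemma mult_fscale_right: "x * fscale c y = fscale c (x * y :: 'a::monoid_add \<Rightarrow>\<^sub>0 complex)"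
  and mult_fscale_left: "fscale c x * y = fscale c (x * y)"
proof -
  have s: "Poly_Mapping.single k a * fscale c y = fscale c (Poly_Mapping.single k a * y)"
    "Poly_Mapping.single k (a * c) * y = fscale c (Poly_Mapping.single k a * y)"
    for k :: 'a and a c and y :: "'a \<Rightarrow>\<^sub>0 complex"
  proof -
    have "y \<in> fs.span (range (\<lambda>k. Poly_Mapping.single k 1))"
      by (rule span_singles) simp
    then show "Poly_Mapping.single k a * fscale c y = fscale c (Poly_Mapping.single k a * y)"
      by (induction rule: fs.span_induct_alt)
        (auto simp: fs.scale_right_distrib fscale_single mult_single algebra_simps)
    have "y \<in> fs.span (range (\<lambda>k. Poly_Mapping.single k 1))"
      by (rule span_singles) simp
    then show "Poly_Mapping.single k (a * c) * y = fscale c (Poly_Mapping.single k a * y)"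
      by (induction rule: fs.span_induct_alt)
        (auto simp: fs.scale_right_distrib fscale_single mult_single algebra_simps)
  qed
  have "x \<in> fs.span (range (\<lambda>k. Poly_Mapping.single k 1))"
    by (rule span_singles) simp
  then show "x * fscale c y = fscale c (x * y)"
    by (induction rule: fs.span_induct_alt)
      (auto simp: fs.scale_right_distrib fscale_single s algebra_simps)
  have "x \<in> fs.span (range (\<lambda>k. Poly_Mapping.single k 1))"
    by (rule span_singles) simp
  then show "fscale c x * y = fscale c (x * y)"
    by (induction rule: fs.span_induct_alt)
      (auto simp: fs.scale_right_distrib fscale_single s algebra_simps)
qed

lemma linear_mult_left: "Vector_Spaces.linear fscale fscale (\<lambda>y. x * y :: 'a::monoid_add \<Rightarrow>\<^sub>0 complex)"
  by unfold_locales (simp_all add: distrib_left mult_fscale_right)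

lemma linear_mult_right: "Vector_Spaces.linear fscale fscale (\<lambda>y. y * x :: 'a::monoid_add \<Rightarrow>\<^sub>0 complex)"
  by unfold_locales (simp_all add: distrib_right mult_fscale_left)

section \<open>Universal enveloping algebras\<close>

lemma single_fword_mult:
  "Poly_Mapping.single (FWord xs) a * Poly_Mapping.single (FWord ys) b =
    Poly_Mapping.single (FWord (xs @ ys)) (a * b :: complex)"
  by (simp add: mult_single plus_fword_def)

lemma one_free_alg: "(1 :: 'g free_alg) = Poly_Mapping.single (FWord []) 1"
  by (metis single_one zero_fword_def)

lemma subspace_free_alg_on: "fs.subspace (free_alg_on G)"
  unfolding fs.subspace_def free_alg_on_def
proof (intro conjI ballI allI)
  show "0 \<in> {a. \<forall>w\<in>Poly_Mapping.keys a. set (letters w) \<subseteq> G}" by simp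
  show "x + y \<in> {a. \<forall>w\<in>Poly_Mapping.keys a. set (letters w) \<subseteq> G}"
    if "x \<in> {a. \<forall>w\<in>Poly_Mapping.keys a. set (letters w) \<subseteq> G}"
      "y \<in> {a. \<forall>w\<in>Poly_Mapping.keys a. set (letters w) \<subseteq> G}" for x y :: "'a free_alg"
    using that keys_add[of x y] by blast
  show "fscale c x \<in> {a. \<forall>w\<in>Poly_Mapping.keys a. set (letters w) \<subseteq> G}"
    if "x \<in> {a. \<forall>w\<in>Poly_Mapping.keys a. set (letters w) \<subseteq> G}" for c and x :: "'a free_alg"
    using that by (auto simp: in_keys_iff)
qed

lemma free_alg_on_mult:
  assumes "a \<in> free_alg_on G" "b \<in> free_alg_on G"
  shows "a * b \<in> free_alg_on G"
proof -
  have "set (letters w) \<subseteq> G" if w: "w \<in> Poly_Mapping.keys (a * b)" for w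
  proof -
    obtain u v where "w = u + v" "u \<in> Poly_Mapping.keys a" "v \<in> Poly_Mapping.keys b"
      using subsetD[OF keys_mult w] by auto
    then show ?thesis using assms by (auto simp: free_alg_on_def plus_fword_def)
  qed
  then show ?thesis by (auto simp: free_alg_on_def)
qed

lemma letter_free_alg_on: "x \<in> G \<Longrightarrow> letter x \<in> free_alg_on G"
  by (simp add: free_alg_on_def letter_def)

lemma one_free_alg_on: "1 \<in> free_alg_on G"
  by (simp add: free_alg_on_def one_free_alg)

lemma free_alg_on_mono: "G \<subseteq> H \<Longrightarrow> free_alg_on G \<subseteq> free_alg_on H"
  by (auto simp: free_alg_on_def)

text \<open>
  The subspace is spanned by words in \<open>G\<close>, which are built by multiplying with letters from
  the left.
\<close>

lemma free_alg_on_word_induct [consumes 1, case_names one letter subspace]: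
  assumes a: "a \<in> free_alg_on G" and one: "1 \<in> S"
    and step: "\<And>x b. x \<in> G \<Longrightarrow> b \<in> free_alg_on G \<Longrightarrow> b \<in> S \<Longrightarrow> letter x * b \<in> S"
    and S: "fs.subspace S"
  shows "a \<in> S"
proof -
  have word: "Poly_Mapping.single (FWord xs) 1 \<in> S \<inter> free_alg_on G" if "set xs \<subseteq> G" for xs
    using that
  proof (induction xs)
    case Nil
    then show ?case using one one_free_alg_on[of G] by (simp add: one_free_alg)
  next
    case (Cons x xs)
    have "Poly_Mapping.single (FWord (x # xs)) 1 = letter x * Poly_Mapping.single (FWord xs) 1"
      by (simp add: letter_def single_fword_mult)
    then show ?case using Cons step[of x] free_alg_on_mult letter_free_alg_on[of x G] by auto
  qed
  have "a \<in> fs.span ((\<lambda>k. Poly_Mapping.single k 1) ` {w. set (letters w) \<subseteq> G})"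
    by (rule span_singles) (use a in \<open>auto simp: free_alg_on_def\<close>)
  moreover have "(\<lambda>k. Poly_Mapping.single k 1) ` {w. set (letters w) \<subseteq> G} \<subseteq> S"
  proof
    fix s :: "'a free_alg" assume "s \<in> (\<lambda>k. Poly_Mapping.single k 1) ` {w. set (letters w) \<subseteq> G}"
    then obtain w where "set (letters w) \<subseteq> G" "s = Poly_Mapping.single (FWord (letters w)) 1" by auto
    then show "s \<in> S" using word by blast
  qed
  ultimately show ?thesis using fs.span_minimal[OF _ S] by blast
qed

text \<open>
  The ideal whose cosets form the enveloping algebra.
\<close>

definition env_ideal :: "(complex \<Rightarrow> 'g::ab_group_add \<Rightarrow> 'g) \<Rightarrow> ('g \<Rightarrow> 'g \<Rightarrow> 'g) \<Rightarrow> 'g set \<Rightarrow> 'g free_alg set"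
  where "env_ideal sc br G = fs.span
    {a * r * b | a r b. a \<in> free_alg_on G \<and> b \<in> free_alg_on G \<and> r \<in> env_relations sc br G}"

lemma env_ideal_mono:
  assumes "G \<subseteq> H" shows "env_ideal sc br G \<subseteq> env_ideal sc br H"
proof -
  have "env_relations sc br G \<subseteq> env_relations sc br H"
    using assms unfolding env_relations_def by blast
  then show ?thesis
    unfolding env_ideal_def using free_alg_on_mono[OF assms] by (intro fs.span_mono) blast
qed

text \<open>
  Closure of \<open>G\<close> under the operations makes the relations elements of the free algebra on
  \<open>G\<close>, although the type of the letters is larger.
\<close>

locale lie_algebra_set =
  fixes sc :: "complex \<Rightarrow> 'g::ab_group_add \<Rightarrow> 'g" and br :: "'g \<Rightarrow> 'g \<Rightarrow> 'g" and G :: "'g set"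
  assumes add_G: "x \<in> G \<Longrightarrow> y \<in> G \<Longrightarrow> x + y \<in> G"
    and sc_G: "x \<in> G \<Longrightarrow> sc c x \<in> G"
    and br_G: "x \<in> G \<Longrightarrow> y \<in> G \<Longrightarrow> br x y \<in> G"
begin

abbreviation "rep \<equiv> env_rep sc br G"
abbreviation "I \<equiv> env_ideal sc br G"
abbreviation "F \<equiv> free_alg_on G"

lemma rep_eq_coset: "rep = coset_rep fscale I"
  by (simp add: env_rep_def env_ideal_def)

lemma linear_rep: "Vector_Spaces.linear fscale fscale rep"
  unfolding rep_eq_coset by (rule coset_rep(1)[OF vector_space_fscale]) (simp add: env_ideal_def)

lemma rep_diff: "x - rep x \<in> I"
  unfolding rep_eq_coset by (rule coset_rep(2)[OF vector_space_fscale]) (simp add: env_ideal_def)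

lemma rep_eq_0_iff: "rep x = 0 \<longleftrightarrow> x \<in> I"
  unfolding rep_eq_coset by (rule coset_rep(3)[OF vector_space_fscale]) (simp add: env_ideal_def)

sublocale rep: Vector_Spaces.linear fscale fscale rep
  by (rule linear_rep)

lemma rep_eq_iff: "rep x = rep y \<longleftrightarrow> x - y \<in> I"
  by (metis rep.diff rep_eq_0_iff right_minus_eq)

lemma subspace_I: "fs.subspace I"
  by (simp add: env_ideal_def)

lemma relations_F: "env_relations sc br G \<subseteq> F"
  unfolding env_relations_def
  using add_G sc_G br_G
  by (auto intro!: fs.subspace_diff[OF subspace_free_alg_on] fs.subspace_scale[OF subspace_free_alg_on]
      letter_free_alg_on free_alg_on_mult)

lemma I_F: "I \<subseteq> F"
  unfolding env_ideal_def
  by (rule fs.span_minimal[OF _ subspace_free_alg_on]) (use relations_F free_alg_on_mult in blast)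

lemma relation_I: "r \<in> env_relations sc br G \<Longrightarrow> r \<in> I"
  unfolding env_ideal_def
  by (rule fs.span_base) (use one_free_alg_on in \<open>force intro: exI[of _ 1]\<close>)

lemma mult_I:
  assumes "x \<in> F" "i \<in> I"
  shows "x * i \<in> I" "i * x \<in> I"
proof -
  let ?R = "{a * r * b | a r b. a \<in> F \<and> b \<in> F \<and> r \<in> env_relations sc br G}"
  have i: "i \<in> fs.span ?R" using assms(2) by (simp add: env_ideal_def)
  show "x * i \<in> I"
  proof (rule linear_mem_span[OF linear_mult_left subspace_I _ i])
    fix y assume "y \<in> ?R"
    then obtain a r b where *: "y = a * r * b" "a \<in> F" "b \<in> F" "r \<in> env_relations sc br G" by blast
    then have "x * y = (x * a) * r * b" "x * a \<in> F"
      using assms(1) free_alg_on_mult by (auto simp: mult.assoc)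
    then show "x * y \<in> I" unfolding env_ideal_def using * by (intro fs.span_base) blast
  qed
  show "i * x \<in> I"
  proof (rule linear_mem_span[OF linear_mult_right subspace_I _ i])
    fix y assume "y \<in> ?R"
    then obtain a r b where *: "y = a * r * b" "a \<in> F" "b \<in> F" "r \<in> env_relations sc br G" by blast
    then have "y * x = a * r * (b * x)" "b * x \<in> F"
      using assms(1) free_alg_on_mult by (auto simp: mult.assoc)
    then show "y * x \<in> I" unfolding env_ideal_def using * by (intro fs.span_base) blast
  qed
qed

lemma rep_F: "x \<in> F \<Longrightarrow> rep x \<in> F"
  using fs.subspace_diff[OF subspace_free_alg_on, of x G "x - rep x"] rep_diff I_F by auto

lemma rep_env_alg: "x \<in> F \<Longrightarrow> rep x \<in> env_alg sc br G"
  by (simp add: env_alg_def)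

lemma rep_rep [simp]: "rep (rep x) = rep x"
  using rep_diff[of x] rep_eq_iff[of x "rep x"] by simp

text \<open>
  This makes the enveloping algebra an algebra under multiplication of representatives.
\<close>

lemma rep_mult:
  assumes "x \<in> F" "y \<in> F"
  shows "rep (x * rep y) = rep (x * y)" "rep (rep x * y) = rep (x * y)"
proof -
  have "x * (y - rep y) \<in> I" "(x - rep x) * y \<in> I"
    by (rule mult_I(1)[OF assms(1) rep_diff], rule mult_I(2)[OF assms(2) rep_diff])
  then show "rep (x * rep y) = rep (x * y)" "rep (rep x * y) = rep (x * y)"
    using rep_eq_iff[of "x * y" "x * rep y"] rep_eq_iff[of "x * y" "rep x * y"]
    by (simp_all add: right_diff_distrib left_diff_distrib)
qed

lemma env_alg_cases:
  assumes "x \<in> env_alg sc br G"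
  shows "x \<in> F" "rep x = x"
  using assms rep_F by (auto simp: env_alg_def)

lemma letter_add_I: "x \<in> G \<Longrightarrow> y \<in> G \<Longrightarrow> letter (x + y) - letter x - letter y \<in> I"
  by (rule relation_I) (unfold env_relations_def, blast)

lemma letter_scale_I: "x \<in> G \<Longrightarrow> letter (sc c x) - fscale c (letter x) \<in> I"
  by (rule relation_I) (unfold env_relations_def, blast)

lemma letter_commutator_I:
  "x \<in> G \<Longrightarrow> y \<in> G \<Longrightarrow> letter x * letter y - letter y * letter x - letter (br x y) \<in> I"
  by (rule relation_I) (unfold env_relations_def, blast)

lemma letter_zero_I: "0 \<in> G \<Longrightarrow> letter 0 \<in> I"
  using letter_add_I[of 0 0] fs.subspace_neg[OF subspace_I, of "letter 0 - letter 0 - letter 0"]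
  by simp

end

text \<open>
  Any family of linear operators indexed by the letters extends to an action of the free algebra; it
  descends to the enveloping algebra when the family is a Lie algebra representation.
\<close>

locale letter_operators = vector_space sc2
  for sc2 :: "complex \<Rightarrow> 'm::ab_group_add \<Rightarrow> 'm" +
  fixes g :: "'g::ab_group_add \<Rightarrow> 'm \<Rightarrow> 'm"
  assumes linear_g: "Vector_Spaces.linear sc2 sc2 (g x)"
begin

definition ext :: "'g free_alg \<Rightarrow> 'm \<Rightarrow> 'm"
  where "ext a v = lin_ext sc2 (\<lambda>w. foldr g (letters w) v) a"

sublocale ext_left: Vector_Spaces.linear fscale sc2 "\<lambda>a. ext a v" for v
  unfolding ext_def by (rule linear_lin_ext) (rule vector_space_axioms)

sublocale g: Vector_Spaces.linear sc2 sc2 "g x" for x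
  by (rule linear_g)

lemma ext_single: "ext (Poly_Mapping.single (FWord xs) c) v = sc2 c (foldr g xs v)"
  by (simp add: ext_def lin_ext_single[OF vector_space_axioms])

lemma ext_letter: "ext (letter x) v = g x v"
  by (simp add: letter_def ext_single)

lemma ext_one: "ext 1 v = v"
  by (simp add: one_free_alg ext_single)

lemma foldr_linear: "foldr g xs (sc2 c v) = sc2 c (foldr g xs v)"
  "foldr g xs (u + v) = foldr g xs u + foldr g xs v"
  by (induction xs) (simp_all add: g.scale g.add)

sublocale ext_right: Vector_Spaces.linear sc2 sc2 "ext a" for a
  by unfold_locales
    (simp_all add: ext_def lin_ext_def foldr_linear scale_right_distrib sum.distrib scale_sum_right mult.commute)

lemma ext_mult: "ext (a * b) v = ext a (ext b v)"
proof -
  have single: "ext (Poly_Mapping.single k 1 * b) v = ext (Poly_Mapping.single k 1) (ext b v)" for k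
  proof -
    have "b \<in> fs.span (range (\<lambda>k. Poly_Mapping.single k 1))"
      by (rule span_singles) simp
    then show ?thesis
    proof (induction rule: fs.span_induct_alt)
      case base
      then show ?case by (simp add: ext_left.zero ext_right.zero)
    next
      case (step c x y)
      then obtain l where x: "x = Poly_Mapping.single l 1" by auto
      obtain xs ys where kl: "k = FWord xs" "l = FWord ys" by (metis fword.exhaust)
      show ?case
        using step by (simp add: x kl distrib_left mult_fscale_right ext_left.add ext_left.scale
            ext_right.add ext_right.scale single_fword_mult ext_single)
    qed
  qed
  have "a \<in> fs.span (range (\<lambda>k. Poly_Mapping.single k 1))"
    by (rule span_singles) simp
  then show ?thesis
    by (induction rule: fs.span_induct_alt)
      (auto simp: ext_left.zero distrib_right mult_fscale_left ext_left.add ext_left.scale single)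
qed

lemma ext_env_ideal:
  assumes add: "\<And>x y v. x \<in> G \<Longrightarrow> y \<in> G \<Longrightarrow> g (x + y) v = g x v + g y v"
    and scale: "\<And>c x v. x \<in> G \<Longrightarrow> g (sc c x) v = sc2 c (g x v)"
    and br: "\<And>x y v. x \<in> G \<Longrightarrow> y \<in> G \<Longrightarrow> g x (g y v) - g y (g x v) = g (br x y) v"
    and i: "i \<in> env_ideal sc br G"
  shows "ext i v = 0"
proof -
  have rel: "ext r v = 0" if "r \<in> env_relations sc br G" for r v
    using that unfolding env_relations_def
    by (auto simp: ext_left.diff ext_left.scale ext_letter ext_mult add scale br)
  have "ext i v \<in> {0}"
  proof (rule linear_mem_span[OF ext_left.linear_axioms _ _ i[unfolded env_ideal_def]])
    fix x assume "x \<in> {a * r * b |a r b. a \<in> free_alg_on G \<and> b \<in> free_alg_on G \<and> r \<in> env_relations sc br G}"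
    then show "ext x v \<in> {0}" by (auto simp: ext_mult rel ext_right.zero)
  qed simp
  then show ?thesis by simp
qed

end

section \<open>The induced Heisenberg module\<close>

text \<open>
  The bracket of two elements with a zero coefficient in matching degrees has to vanish; this is where
  the conditions on the form enter.
\<close>

locale heisenberg_induced = heisenberg scale \<hh> form + vector_space scale
  for scale :: "complex \<Rightarrow> 'v::ab_group_add \<Rightarrow> 'v" and \<hh> :: "'v set"
    and form :: "'v \<Rightarrow> 'v \<Rightarrow> complex" +
  assumes subspace_h: "subspace \<hh>"
    and form_0_right: "form u 0 = 0" and form_0_left: "form 0 u = 0"
begin

lemma heis_alg_iff: "x \<in> heis_alg \<hh> \<longleftrightarrow> (\<forall>n. Poly_Mapping.lookup (fst x) n \<in> \<hh>)"
  by (simp add: heis_alg_def)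

lemma lookup_heis_scale: "Poly_Mapping.lookup (fst (heis_scale scale c x)) n = scale c (Poly_Mapping.lookup (fst x) n)"
  by (simp add: heis_scale_def Poly_Mapping.map.rep_eq when_def)

text \<open>
  \<open>L\<close> is the whole Heisenberg algebra and \<open>P\<close> its nonnegative part.
\<close>

sublocale L: lie_algebra_set "heis_scale scale" "heis_bracket form" "heis_alg \<hh>"
  by unfold_locales
    (auto simp: heis_alg_iff lookup_add lookup_heis_scale heis_bracket_def
      subspace_add[OF subspace_h] subspace_scale[OF subspace_h] subspace_0[OF subspace_h])

sublocale P: lie_algebra_set "heis_scale scale" "heis_bracket form" "heis_alg_nonneg \<hh>"
  by unfold_locales
    (auto simp: heis_alg_nonneg_def heis_alg_iff lookup_add lookup_heis_scale heis_bracket_def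
      subspace_add[OF subspace_h] subspace_scale[OF subspace_h] subspace_0[OF subspace_h])

lemma nonneg_subset: "heis_alg_nonneg \<hh> \<subseteq> heis_alg \<hh>"
  by (auto simp: heis_alg_nonneg_def)

lemma mode_heis_alg: "u \<in> \<hh> \<Longrightarrow> (Poly_Mapping.single n u, c) \<in> heis_alg \<hh>"
  by (simp add: heis_alg_iff lookup_single when_def subspace_0[OF subspace_h])

lemma mode_heis_alg_nonneg: "u \<in> \<hh> \<Longrightarrow> n \<ge> 0 \<Longrightarrow> (Poly_Mapping.single n u, c) \<in> heis_alg_nonneg \<hh>"
  by (simp add: heis_alg_nonneg_def mode_heis_alg lookup_single when_def)

lemma central_heis_alg_nonneg: "(0, c) \<in> heis_alg_nonneg \<hh>"
  by (simp add: heis_alg_nonneg_def heis_alg_iff subspace_0[OF subspace_h])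

text \<open>
  The only pairs of opposite nonnegative degrees are $(0,0)$, where the factor $m$ vanishes.
\<close>

lemma heis_bracket_nonneg:
  assumes "x \<in> heis_alg_nonneg \<hh>" "y \<in> heis_alg_nonneg \<hh>"
  shows "heis_bracket form x y = 0"
proof -
  have "of_int m * form (Poly_Mapping.lookup (fst x) m) (Poly_Mapping.lookup (fst y) (- m)) = 0" for m
  proof -
    consider "m < 0" | "m = 0" | "- m < 0" by linarith
    then show ?thesis
      using assms by cases (auto simp: heis_alg_nonneg_def form_0_left form_0_right)
  qed
  then show ?thesis
    unfolding heis_bracket_def zero_prod_def by (simp only: sum.neutral_const)
qed

text \<open>
  The one-dimensional module from which the Heisenberg module is induced, as an instance of the
  extension of operators to the free algebra.
\<close>

sublocale \<chi>: letter_operators "(*)" "\<lambda>(x::'v heis_elt) z. snd x * z"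
  by unfold_locales (simp_all add: algebra_simps)

\<comment> \<open>For multiplication as scalar multiplication this rule is the reverse of associativity.\<close>
declare \<chi>.scale_scale [simp del]

lemma heis_vac_action_ext: "heis_vac_action b z = \<chi>.ext b z"
proof -
  have "foldr (\<lambda>x z. snd x * z) xs z = prod_list (map snd xs) * z" for xs :: "'v heis_elt list" and z
    by (induction xs) (simp_all add: mult.assoc)
  then show ?thesis
    by (simp add: heis_vac_action_def \<chi>.ext_def lin_ext_def sum_distrib_right mult.assoc)
qed

text \<open>
  Brackets in the nonnegative part vanish and the central component is additive, so the character
  respects the defining relations.
\<close>

lemma heis_vac_action_ideal:
  assumes "i \<in> env_ideal (heis_scale scale) (heis_bracket form) (heis_alg_nonneg \<hh>)"
  shows "heis_vac_action i z = 0"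
  unfolding heis_vac_action_ext
  by (rule \<chi>.ext_env_ideal[OF _ _ _ assms])
    (simp_all add: distrib_right heis_bracket_nonneg heis_scale_def)

definition rels :: "'v heis_tensor set"
  where "rels = tensor_relations U_nonneg fscale U_alg (\<lambda>x b. U_rep (x * b)) (*) UNIV heis_vac_action"

lemma space_rep_coset: "space_rep = coset_rep fscale (fs.span rels)"
  by (simp add: space_rep_def rels_def)

lemma linear_space_rep: "Vector_Spaces.linear fscale fscale space_rep"
  unfolding space_rep_coset by (rule coset_rep(1)[OF vector_space_fscale]) simp

sublocale sr: Vector_Spaces.linear fscale fscale space_rep
  by (rule linear_space_rep)

lemma space_rep_diff: "x - space_rep x \<in> fs.span rels"
  unfolding space_rep_coset by (rule coset_rep(2)[OF vector_space_fscale]) simp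

lemma space_rep_0_iff: "space_rep x = 0 \<longleftrightarrow> x \<in> fs.span rels"
  unfolding space_rep_coset by (rule coset_rep(3)[OF vector_space_fscale]) simp

lemma space_rep_eqI: "x - y \<in> rels \<Longrightarrow> space_rep x = space_rep y"
  using space_rep_0_iff[of "x - y"] fs.span_base[of "x - y" rels] by (simp add: sr.diff)

abbreviation pure :: "'v heis_elt free_alg \<Rightarrow> complex \<Rightarrow> 'v heis_tensor"
  where "pure x z \<equiv> Poly_Mapping.single (x, z) 1"

lemma rels_cases [consumes 1, case_names add_left add_right scale_left scale_right balance]:
  assumes "r \<in> rels"
  obtains x x' w where "r = pure (x + x') w - pure x w - pure x' w" "x \<in> U_alg" "x' \<in> U_alg"
  | x w w' where "r = pure x (w + w') - pure x w - pure x w'" "x \<in> U_alg"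
  | c x w where "r = pure (fscale c x) w - fscale c (pure x w)" "x \<in> U_alg"
  | c x w where "r = pure x (c * w) - fscale c (pure x w)" "x \<in> U_alg"
  | x b w where "r = pure (U_rep (x * b)) w - pure x (heis_vac_action b w)" "x \<in> U_alg" "b \<in> U_nonneg"
  using assms unfolding rels_def tensor_relations_def Let_def by blast

lemma rels_intros:
  shows "x \<in> U_alg \<Longrightarrow> x' \<in> U_alg \<Longrightarrow> pure (x + x') w - pure x w - pure x' w \<in> rels"
    and "x \<in> U_alg \<Longrightarrow> pure x (w + w') - pure x w - pure x w' \<in> rels"
    and "x \<in> U_alg \<Longrightarrow> pure (fscale c x) w - fscale c (pure x w) \<in> rels"
    and "x \<in> U_alg \<Longrightarrow> pure x (c * w) - fscale c (pure x w) \<in> rels"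
    and "x \<in> U_alg \<Longrightarrow> b \<in> U_nonneg \<Longrightarrow> pure (U_rep (x * b)) w - pure x (heis_vac_action b w) \<in> rels"
  unfolding rels_def tensor_relations_def Let_def by blast+

text \<open>
  The class of $a \otimes 1$.  As $a \otimes z = z(a \otimes 1)$, these classes exhaust the induced
  module.
\<close>

definition q :: "'v heis_elt free_alg \<Rightarrow> 'v heis_tensor"
  where "q a = space_rep (pure (U_rep a) 1)"

lemma q_add: "a \<in> L.F \<Longrightarrow> b \<in> L.F \<Longrightarrow> q (a + b) = q a + q b"
  using rels_intros(1)[OF L.rep_env_alg L.rep_env_alg, of a b 1]
    space_rep_eqI[of "pure (U_rep a + U_rep b) 1" "pure (U_rep a) 1 + pure (U_rep b) 1"]
  by (simp add: q_def L.rep.add sr.add algebra_simps)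

lemma q_fscale: "a \<in> L.F \<Longrightarrow> q (fscale c a) = fscale c (q a)"
  using rels_intros(3)[OF L.rep_env_alg, of a c 1]
    space_rep_eqI[of "pure (fscale c (U_rep a)) 1" "fscale c (pure (U_rep a) 1)"]
  by (simp add: q_def L.rep.scale sr.scale)

lemma q_cong: "a - b \<in> L.I \<Longrightarrow> q a = q b"
  unfolding q_def using L.rep_eq_iff[of a b] by simp

lemma q_ideal: "i \<in> L.I \<Longrightarrow> q i = 0"
proof -
  have "0 \<in> L.F" by (rule fs.subspace_0[OF subspace_free_alg_on])
  from q_fscale[OF this, of 0] have "q 0 = 0" by simp
  then show "i \<in> L.I \<Longrightarrow> q i = 0" using q_cong[of i 0] by simp
qed

lemma q_diff:
  assumes "a \<in> L.F" "b \<in> L.F"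
  shows "q (a - b) = q a - q b"
  using q_add[of "a - b" b] fs.subspace_diff[OF subspace_free_alg_on assms] assms by simp

lemma space_rep_single:
  assumes "x \<in> U_alg"
  shows "space_rep (Poly_Mapping.single (x, z) c) = fscale (c * z) (q x)"
proof -
  have "space_rep (pure x (z * 1)) = space_rep (fscale z (pure x 1))"
    by (rule space_rep_eqI) (use rels_intros(4)[OF assms, of z 1] in simp)
  moreover have "Poly_Mapping.single (x, z) c = fscale c (pure x z)"
    by (rule single_eq_fscale)
  ultimately show ?thesis
    using L.env_alg_cases[OF assms] by (simp add: sr.scale q_def)
qed

lemma subspace_q_image: "fs.subspace (q ` L.F)"
  unfolding fs.subspace_def
proof (intro conjI ballI allI)
  note F = subspace_free_alg_on[of "heis_alg \<hh>"]
  show "0 \<in> q ` L.F"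
    using q_ideal[of 0] fs.subspace_0[OF F] fs.subspace_0[OF L.subspace_I] by (metis imageI)
  show "x + y \<in> q ` L.F" if "x \<in> q ` L.F" "y \<in> q ` L.F" for x y
  proof -
    obtain a b where ab: "a \<in> L.F" "b \<in> L.F" "x = q a" "y = q b" using \<open>x \<in> _\<close> \<open>y \<in> _\<close> by blast
    show ?thesis unfolding ab(3,4) q_add[OF ab(1,2), symmetric]
      by (rule imageI) (rule fs.subspace_add[OF F ab(1,2)])
  qed
  show "fscale c x \<in> q ` L.F" if "x \<in> q ` L.F" for c x
  proof -
    obtain a where a: "a \<in> L.F" "x = q a" using \<open>x \<in> _\<close> by blast
    show ?thesis unfolding a(2) q_fscale[OF a(1), symmetric]
      by (rule imageI) (rule fs.subspace_scale[OF F a(1)])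
  qed
qed

lemma space_eq: "space = q ` L.F"
proof
  show "space \<subseteq> q ` L.F"
  proof
    fix w assume "w \<in> space"
    then obtain y where y: "w = space_rep y" "Poly_Mapping.keys y \<subseteq> U_alg \<times> UNIV"
      by (auto simp: space_def)
    show "w \<in> q ` L.F"
      unfolding y(1)
    proof (rule linear_mem_span[OF linear_space_rep subspace_q_image _ span_singles[OF y(2)]])
      fix x :: "'v heis_tensor" assume "x \<in> (\<lambda>k. Poly_Mapping.single k 1) ` (U_alg \<times> UNIV)"
      then obtain a z where a: "a \<in> U_alg" "x = pure a z" by blast
      then show "space_rep x \<in> q ` L.F"
        using space_rep_single[OF a(1), of z 1] fs.subspace_scale[OF subspace_q_image] L.env_alg_cases(1)
        by (simp add: imageI)
    qed
  qed
  show "q ` L.F \<subseteq> space"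
    unfolding space_def q_def using L.rep_env_alg by (auto intro!: imageI)
qed

lemma q_space: "a \<in> L.F \<Longrightarrow> q a \<in> space"
  by (simp add: space_eq)

lemma subspace_space: "fs.subspace space"
  by (simp add: space_eq subspace_q_image)

lemma vac_eq: "vac = q 1"
  by (simp add: vac_def q_def)

lemma vac_space: "vac \<in> space"
  by (simp add: vac_eq q_space one_free_alg_on)

definition pre_mult :: "'v heis_elt free_alg \<Rightarrow> 'v heis_tensor \<Rightarrow> 'v heis_tensor"
  where "pre_mult l = lin_ext fscale (\<lambda>(x, z). pure (U_rep (l * x)) z)"

text \<open>
  Left multiplication by an arbitrary element of the enveloping algebra; the action of the modes is a
  special case.  Having it for all elements shows that \<open>q\<close> of a product depends on the right
  factor through its \<open>q\<close> only.
\<close>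

definition left_mult :: "'v heis_elt free_alg \<Rightarrow> 'v heis_tensor \<Rightarrow> 'v heis_tensor"
  where "left_mult l y = space_rep (pre_mult l y)"

sublocale pm: Vector_Spaces.linear fscale fscale "pre_mult l" for l
  unfolding pre_mult_def by (rule linear_lin_ext) (rule vector_space_fscale)

sublocale lm: Vector_Spaces.linear fscale fscale "left_mult l" for l
  by unfold_locales (simp_all add: left_mult_def pm.add pm.scale sr.add sr.scale)

lemma act_eq_left_mult: "act u n = left_mult (letter (Poly_Mapping.single n u, 0))"
  by (rule ext) (simp add: act_def left_mult_def pre_mult_def lin_ext_def fscale_single case_prod_unfold)

lemma pre_mult_pure: "pre_mult l (pure x z) = pure (U_rep (l * x)) z"
  by (simp add: pre_mult_def lin_ext_single[OF vector_space_fscale])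

lemma pre_mult_rels:
  assumes l: "l \<in> L.F" and r: "r \<in> rels"
  shows "pre_mult l r \<in> rels"
proof -
  have U: "U_rep (l * x) \<in> U_alg" if "x \<in> U_alg" for x
    using l L.env_alg_cases(1)[OF that] by (intro L.rep_env_alg free_alg_on_mult)
  from r show ?thesis
  proof (cases rule: rels_cases)
    case (add_left x x' w)
    then show ?thesis
      using rels_intros(1)[OF U U] by (simp add: pm.diff pre_mult_pure distrib_left L.rep.add)
  next
    case (add_right x w w')
    then show ?thesis using rels_intros(2)[OF U] by (simp add: pm.diff pre_mult_pure)
  next
    case (scale_left c x w)
    then show ?thesis
      using rels_intros(3)[OF U] by (simp add: pm.diff pm.scale pre_mult_pure mult_fscale_right L.rep.scale)
  next
    case (scale_right c x w)
    then show ?thesis using rels_intros(4)[OF U] by (simp add: pm.diff pm.scale pre_mult_pure)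
  next
    case (balance x b w)
    have x: "x \<in> L.F" using L.env_alg_cases(1) balance by blast
    have b: "b \<in> L.F"
      using P.env_alg_cases(1)[OF balance(3)] free_alg_on_mono[OF nonneg_subset] by blast
    have "U_rep (l * U_rep (x * b)) = U_rep (U_rep (l * x) * b)"
      using l x b by (simp add: L.rep_mult free_alg_on_mult mult.assoc)
    then show ?thesis
      using rels_intros(5)[OF U balance(3), of x w] balance by (simp add: pm.diff pre_mult_pure)
  qed
qed

lemma left_mult_space_rep:
  assumes "l \<in> L.F"
  shows "left_mult l (space_rep y) = space_rep (pre_mult l y)"
proof -
  have "pre_mult l (y - space_rep y) \<in> fs.span rels"
    by (rule linear_mem_span[OF pm.linear_axioms fs.subspace_span _ space_rep_diff])
      (simp add: pre_mult_rels[OF assms] fs.span_base)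
  then have "space_rep (pre_mult l (y - space_rep y)) = 0"
    by (simp add: space_rep_0_iff)
  then show ?thesis by (simp add: left_mult_def pm.diff sr.diff)
qed

lemma left_mult_q:
  assumes "l \<in> L.F" "a \<in> L.F"
  shows "left_mult l (q a) = q (l * a)"
  unfolding q_def left_mult_space_rep[OF assms(1)] using assms by (simp add: pre_mult_pure L.rep_mult)

lemma mode_F: "u \<in> \<hh> \<Longrightarrow> letter (Poly_Mapping.single n u, c) \<in> L.F"
  by (intro letter_free_alg_on mode_heis_alg)

lemma act_q: "u \<in> \<hh> \<Longrightarrow> a \<in> L.F \<Longrightarrow> act u n (q a) = q (letter (Poly_Mapping.single n u, 0) * a)"
  unfolding act_eq_left_mult by (intro left_mult_q mode_F)

lemma linear_act: "Vector_Spaces.linear fscale fscale (act u n)"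
  unfolding act_eq_left_mult by (rule lm.linear_axioms)

lemma act_space: "u \<in> \<hh> \<Longrightarrow> w \<in> space \<Longrightarrow> act u n w \<in> space"
  unfolding space_eq by (auto simp: act_q intro!: imageI free_alg_on_mult mode_F)

text \<open>
  Here the balancing relation of the tensor product enters.  It is stated for representatives in the
  enveloping algebra of the nonnegative part, which differ from letters by elements of an ideal on which
  the character vanishes.
\<close>

lemma q_right:
  assumes a: "a \<in> L.F" and x: "x \<in> heis_alg_nonneg \<hh>"
  shows "q (a * letter x) = fscale (snd x) (q a)"
proof -
  let ?b = "P.rep (letter x)"
  have xF: "letter x \<in> L.F" using x nonneg_subset by (intro letter_free_alg_on) blast
  have b: "?b \<in> U_nonneg" by (intro P.rep_env_alg letter_free_alg_on x)
  have bF: "?b \<in> L.F"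
    using P.env_alg_cases(1)[OF b] free_alg_on_mono[OF nonneg_subset] by blast
  have "letter x - ?b \<in> L.I"
    using P.rep_diff env_ideal_mono[OF nonneg_subset] by blast
  then have "a * letter x - a * ?b \<in> L.I"
    using L.mult_I(1)[OF a] by (simp add: right_diff_distrib[symmetric])
  then have 1: "q (a * letter x) = q (a * ?b)" by (rule q_cong)
  have "heis_vac_action ?b 1 = heis_vac_action (letter x) 1"
    using heis_vac_action_ideal[OF P.rep_diff[of "letter x"], of 1]
    by (simp add: heis_vac_action_ext \<chi>.ext_left.diff)
  then have \<chi>: "heis_vac_action ?b 1 = snd x"
    by (simp add: heis_vac_action_ext \<chi>.ext_letter)
  have "space_rep (pure (U_rep (U_rep a * ?b)) 1) = space_rep (pure (U_rep a) (snd x))"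
    by (rule space_rep_eqI) (use rels_intros(5)[OF L.rep_env_alg[OF a] b, of 1] \<chi> in simp)
  also have "\<dots> = fscale (snd x) (q a)"
    using space_rep_single[OF L.rep_env_alg[OF a], of "snd x" 1] by (simp add: q_def)
  finally show ?thesis
    unfolding 1 using a bF by (simp add: q_def L.rep_mult)
qed

lemma heis_bracket_central: "heis_bracket form (0, c) x = 0"
  by (simp add: heis_bracket_def zero_prod_def)

text \<open>
  Balancing only gives this for words with the central letter on the right.  The central letter
  commutes with all letters modulo the ideal, so it can be moved there.
\<close>

lemma q_central:
  assumes "a \<in> L.F"
  shows "q (letter (0, c) * a) = fscale c (q a)"
proof -
  have C: "(0, c) \<in> heis_alg \<hh>" using central_heis_alg_nonneg nonneg_subset by blast
  have CF: "letter (0, c) \<in> L.F" using C by (rule letter_free_alg_on)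
  have "a \<in> {a \<in> L.F. q (letter (0, c) * a) = fscale c (q a)}"
    using assms
  proof (induction rule: free_alg_on_word_induct)
    case one
    show ?case
      using q_right[OF one_free_alg_on central_heis_alg_nonneg, of c] by (simp add: one_free_alg_on)
  next
    case (letter x b)
    have x: "letter x \<in> L.F" using letter(1) by (rule letter_free_alg_on)
    have "letter (heis_bracket form (0, c) x) \<in> L.I"
      unfolding heis_bracket_central
      by (rule L.letter_zero_I) (simp add: heis_alg_iff subspace_0[OF subspace_h])
    then have "letter (0, c) * letter x - letter x * letter (0, c) \<in> L.I"
      using fs.subspace_add[OF L.subspace_I L.letter_commutator_I[OF C letter(1)]] by fastforce
    then have "(letter (0, c) * letter x - letter x * letter (0, c)) * b \<in> L.I"
      using L.mult_I(2) letter(2) by blast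
    then have "q (letter (0, c) * (letter x * b)) = q (letter x * (letter (0, c) * b))"
      by (intro q_cong) (simp add: left_diff_distrib mult.assoc)
    also have "\<dots> = left_mult (letter x) (q (letter (0, c) * b))"
      using x CF letter(2) by (simp add: left_mult_q free_alg_on_mult)
    also have "\<dots> = fscale c (q (letter x * b))"
      using letter x by (simp add: lm.scale left_mult_q)
    finally show ?case using x letter(2) free_alg_on_mult by blast
  next
    case subspace
    show ?case
      unfolding fs.subspace_def
      using fs.subspace_0[OF subspace_free_alg_on] fs.subspace_add[OF subspace_free_alg_on]
        fs.subspace_scale[OF subspace_free_alg_on] CF q_ideal[OF fs.subspace_0[OF L.subspace_I]]
      by (auto simp: distrib_left q_add q_fscale free_alg_on_mult mult_fscale_right
          fs.scale_right_distrib mult.commute)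
  qed
  then show ?thesis by simp
qed

lemma act_commutator:
  assumes u: "u \<in> \<hh>" and v: "v \<in> \<hh>" and w: "w \<in> space"
  shows "act u m (act v n w) - act v n (act u m w) =
    fscale (if m + n = 0 then of_int m * form u v else 0) w"
proof -
  obtain a where a: "a \<in> L.F" "w = q a" using w by (auto simp: space_eq)
  let ?u = "letter (Poly_Mapping.single m u, 0)" and ?v = "letter (Poly_Mapping.single n v, 0)"
  let ?c = "if m + n = 0 then of_int m * form u v else 0"
  have uv: "?u \<in> L.F" "?v \<in> L.F" "letter (0, ?c) \<in> L.F"
    using mode_F[OF u] mode_F[OF v] central_heis_alg_nonneg nonneg_subset
    by (blast intro: letter_free_alg_on)+
  have "?u * ?v - ?v * ?u - letter (0, ?c) \<in> L.I"
    using L.letter_commutator_I[OF mode_heis_alg[OF u] mode_heis_alg[OF v], of m 0 n 0]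
    by (simp add: heis_bracket_single form_0_left form_0_right eq_neg_iff_add_eq_0)
  from q_cong[of "(?u * ?v - ?v * ?u) * a" "letter (0, ?c) * a"] L.mult_I(2)[OF a(1) this]
  have "q (?u * (?v * a) - ?v * (?u * a)) = q (letter (0, ?c) * a)"
    by (simp add: left_diff_distrib mult.assoc)
  then show ?thesis
    using u v uv a by (simp add: act_q q_diff q_central free_alg_on_mult)
qed

lemma act_vac: "u \<in> \<hh> \<Longrightarrow> n \<ge> 0 \<Longrightarrow> act u n vac = 0"
  using q_right[OF one_free_alg_on mode_heis_alg_nonneg[of u n 0]]
  by (simp add: vac_eq act_q one_free_alg_on)

lemma act_add_left:
  assumes u: "u \<in> \<hh>" and v: "v \<in> \<hh>" and w: "w \<in> space"
  shows "act (u + v) n w = act u n w + act v n w"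
proof -
  obtain a where a: "a \<in> L.F" "w = q a" using w by (auto simp: space_eq)
  let ?l = "\<lambda>u. letter (Poly_Mapping.single n u, 0)"
  have "?l (u + v) - (?l u + ?l v) \<in> L.I"
    using L.letter_add_I[OF mode_heis_alg[OF u] mode_heis_alg[OF v], of n 0 n 0]
    by (simp add: single_add algebra_simps)
  from q_cong[of "?l (u + v) * a" "(?l u + ?l v) * a"] L.mult_I(2)[OF a(1) this]
  have "q (?l (u + v) * a) = q (?l u * a + ?l v * a)"
    by (simp add: left_diff_distrib distrib_right)
  then show ?thesis
    using u v a mode_F subspace_add[OF subspace_h u v] by (simp add: act_q q_add free_alg_on_mult)
qed

lemma act_scale_left:
  assumes u: "u \<in> \<hh>" and w: "w \<in> space"
  shows "act (scale c u) n w = fscale c (act u n w)"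
proof -
  obtain a where a: "a \<in> L.F" "w = q a" using w by (auto simp: space_eq)
  let ?l = "\<lambda>u. letter (Poly_Mapping.single n u, 0)"
  have "?l (scale c u) - fscale c (?l u) \<in> L.I"
    using L.letter_scale_I[OF mode_heis_alg[OF u], of c n 0]
    by (simp add: heis_scale_def Poly_Mapping.map_single)
  from q_cong[of "?l (scale c u) * a" "fscale c (?l u) * a"] L.mult_I(2)[OF a(1) this]
  have "q (?l (scale c u) * a) = q (fscale c (?l u * a))"
    by (simp add: left_diff_distrib mult_fscale_left)
  then show ?thesis
    using u a mode_F subspace_scale[OF subspace_h u] by (simp add: act_q q_fscale free_alg_on_mult)
qed

text \<open>
  A letter is a finite sum of modes and a central element, and the latter acts as a scalar; so a
  subspace stable under the modes is stable under all letters.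
\<close>

lemma space_cyclic:
  assumes S: "fs.subspace S" "vac \<in> S"
    and act: "\<And>u n w. u \<in> \<hh> \<Longrightarrow> w \<in> space \<Longrightarrow> w \<in> S \<Longrightarrow> act u n w \<in> S"
  shows "space \<subseteq> S"
proof -
  have step: "q (letter x * a) \<in> S" if x: "x \<in> heis_alg \<hh>" and a: "a \<in> L.F" and aS: "q a \<in> S" for x a
  proof -
    obtain f c where fc: "x = (f, c)" by fastforce
    have f: "Poly_Mapping.lookup f n \<in> \<hh>" for n using x by (simp add: fc heis_alg_iff)
    have C: "(0, d) \<in> heis_alg \<hh>" for d using central_heis_alg_nonneg nonneg_subset by blast
    have CS: "q (letter (0, d) * a) \<in> S" for d
      using q_central[OF a] aS fs.subspace_scale[OF S(1)] by simp
    have split: "q (letter (y + z) * a) = q (letter y * a) + q (letter z * a)"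
      if "y \<in> heis_alg \<hh>" "z \<in> heis_alg \<hh>" for y z
    proof -
      have "letter (y + z) - (letter y + letter z) \<in> L.I"
        using L.letter_add_I[OF that] by (simp add: algebra_simps)
      from q_cong[of "letter (y + z) * a" "(letter y + letter z) * a"] L.mult_I(2)[OF a this]
      show ?thesis
        using that a by (simp add: left_diff_distrib distrib_right q_add free_alg_on_mult letter_free_alg_on)
    qed
    have sum: "q (letter (\<Sum>n\<in>K. Poly_Mapping.single n (Poly_Mapping.lookup f n), 0) * a) \<in> S \<and>
        ((\<Sum>n\<in>K. Poly_Mapping.single n (Poly_Mapping.lookup f n), 0) \<in> heis_alg \<hh>)" if "finite K" for K
      using that
    proof (induction K rule: finite_induct)
      case empty
      then show ?case using CS C by simp
    next
      case (insert n K)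
      let ?y = "(Poly_Mapping.single n (Poly_Mapping.lookup f n), 0 :: complex)"
      let ?z = "(\<Sum>n\<in>K. Poly_Mapping.single n (Poly_Mapping.lookup f n), 0 :: complex)"
      have y: "?y \<in> heis_alg \<hh>" by (rule mode_heis_alg[OF f])
      have z: "?z \<in> heis_alg \<hh>" "q (letter ?z * a) \<in> S" using insert.IH by blast+
      have yS: "q (letter ?y * a) \<in> S"
        using act[OF f q_space[OF a] aS, of n] act_q[OF f a, of n] by simp
      have yz: "(\<Sum>n\<in>insert n K. Poly_Mapping.single n (Poly_Mapping.lookup f n), 0) = ?y + ?z"
        using insert.hyps by simp
      show ?case
        unfolding yz split[OF y z(1)] using fs.subspace_add[OF S(1) yS z(2)] L.add_G[OF y z(1)] by blast
    qed
    have "f = (\<Sum>n\<in>Poly_Mapping.keys f. Poly_Mapping.single n (Poly_Mapping.lookup f n))"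
      by (rule poly_mapping_eqI)
        (simp add: lookup_sum lookup_single when_def in_keys_iff cong: if_cong)
    then have f0: "q (letter (f, 0) * a) \<in> S" "(f, 0) \<in> heis_alg \<hh>"
      using sum[of "Poly_Mapping.keys f"] by auto
    have "x = (f, 0) + (0, c)" by (simp add: fc)
    then show ?thesis
      using split[OF f0(2) C[of c]] fs.subspace_add[OF S(1) f0(1) CS[of c]] by simp
  qed
  have "a \<in> {a \<in> L.F. q a \<in> S}" if "a \<in> L.F" for a
    using that
  proof (induction rule: free_alg_on_word_induct)
    case one
    then show ?case using S(2) by (simp add: vac_eq one_free_alg_on)
  next
    case (letter x b)
    then show ?case using step by (simp add: free_alg_on_mult letter_free_alg_on)
  next
    case subspace
    show ?case
      unfolding fs.subspace_def
      using fs.subspace_0[OF subspace_free_alg_on] fs.subspace_add[OF subspace_free_alg_on]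
        fs.subspace_scale[OF subspace_free_alg_on] q_ideal[OF fs.subspace_0[OF L.subspace_I]]
        fs.subspace_0[OF S(1)] fs.subspace_add[OF S(1)] fs.subspace_scale[OF S(1)]
      by (auto simp: q_add q_fscale)
  qed
  then show ?thesis by (auto simp: space_eq)
qed

text \<open>
  The operators extend to the free algebra and kill the ideal because they represent the Heisenberg
  algebra.  The nonnegative part acts on $v_0$ through the character, which is compatibility with
  balancing.
\<close>

lemma universal:
  fixes sc2 :: "complex \<Rightarrow> 'm::ab_group_add \<Rightarrow> 'm" and A :: "'v \<Rightarrow> int \<Rightarrow> 'm \<Rightarrow> 'm" and v0 :: 'm
  assumes vs: "vector_space sc2"
    and lin: "\<And>u n. Vector_Spaces.linear sc2 sc2 (A u n)"
    and add: "\<And>u v n w. u \<in> \<hh> \<Longrightarrow> v \<in> \<hh> \<Longrightarrow> A (u + v) n w = A u n w + A v n w"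
    and scale: "\<And>c u n w. u \<in> \<hh> \<Longrightarrow> A (scale c u) n w = sc2 c (A u n w)"
    and comm: "\<And>u v m n w. u \<in> \<hh> \<Longrightarrow> v \<in> \<hh> \<Longrightarrow> A u m (A v n w) - A v n (A u m w) =
      (if m + n = 0 then sc2 (of_int m * form u v) w else 0)"
    and v0: "\<And>u n. u \<in> \<hh> \<Longrightarrow> n \<ge> 0 \<Longrightarrow> A u n v0 = 0"
  obtains T where "Vector_Spaces.linear fscale sc2 T" "T vac = v0"
    "\<And>u n w. u \<in> \<hh> \<Longrightarrow> w \<in> space \<Longrightarrow> T (act u n w) = A u n (T w)"
proof -
  interpret m: vector_space sc2 by fact
  interpret A: Vector_Spaces.linear sc2 sc2 "A u n" for u n by (rule lin)
  define g :: "'v heis_elt \<Rightarrow> 'm \<Rightarrow> 'm"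
    where "g x w = (\<Sum>n\<in>Poly_Mapping.keys (fst x). A (Poly_Mapping.lookup (fst x) n) n w) + sc2 (snd x) w" for x w
  have h0: "0 \<in> \<hh>" by (rule subspace_0[OF subspace_h])
  have A0: "A 0 n w = 0" for n w
    using scale[OF h0, of 0] by simp
  have g_eq: "g x w = (\<Sum>n\<in>S. A (Poly_Mapping.lookup (fst x) n) n w) + sc2 (snd x) w"
    if "finite S" "Poly_Mapping.keys (fst x) \<subseteq> S" for x w S
    unfolding g_def using that
    by (auto intro!: sum.mono_neutral_left simp: in_keys_iff A0)
  interpret g: letter_operators sc2 g
  proof unfold_locales
    show "g x (v + w) = g x v + g x w" for x v w
      by (simp add: g_def A.add sum.distrib m.scale_right_distrib)
    show "g x (sc2 c w) = sc2 c (g x w)" for x c w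
      by (simp add: g_def A.scale m.scale_sum_right m.scale_right_distrib mult.commute)
  qed
  have g_add: "g (x + y) w = g x w + g y w" if "x \<in> heis_alg \<hh>" "y \<in> heis_alg \<hh>" for x y w
  proof -
    let ?S = "Poly_Mapping.keys (fst x) \<union> Poly_Mapping.keys (fst y)"
    have "Poly_Mapping.keys (fst (x + y)) \<subseteq> ?S" using keys_add[of "fst x" "fst y"] by simp
    then show ?thesis
      using that
      by (simp add: g_eq[of ?S] lookup_add add heis_alg_iff sum.distrib m.scale_left_distrib)
  qed
  have g_scale: "g (heis_scale scale c x) w = sc2 c (g x w)" if "x \<in> heis_alg \<hh>" for c x w
  proof -
    let ?S = "Poly_Mapping.keys (fst x)"
    have "Poly_Mapping.keys (fst (heis_scale scale c x)) \<subseteq> ?S"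
      by (auto simp: in_keys_iff lookup_heis_scale)
    moreover have "snd (heis_scale scale c x) = c * snd x" by (simp add: heis_scale_def)
    ultimately show ?thesis
      using that
      by (simp add: g_eq[of ?S] lookup_heis_scale scale heis_alg_iff m.scale_sum_right m.scale_right_distrib)
  qed
  have g_br: "g x (g y w) - g y (g x w) = g (heis_bracket form x y) w"
    if x: "x \<in> heis_alg \<hh>" and y: "y \<in> heis_alg \<hh>" for x y w
  proof -
    let ?x = "Poly_Mapping.lookup (fst x)" and ?y = "Poly_Mapping.lookup (fst y)"
    let ?X = "Poly_Mapping.keys (fst x)" and ?Y = "Poly_Mapping.keys (fst y)"
    have hx: "?x m \<in> \<hh>" and hy: "?y m \<in> \<hh>" for m using x y by (simp_all add: heis_alg_iff)
    have "g x (g y w) - g y (g x w) =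
        (\<Sum>m\<in>?X. \<Sum>n\<in>?Y. A (?x m) m (A (?y n) n w)) - (\<Sum>n\<in>?Y. \<Sum>m\<in>?X. A (?y n) n (A (?x m) m w))"
      by (simp add: g_def A.add A.sum A.scale sum.distrib m.scale_right_distrib m.scale_sum_right mult.commute)
    also have "\<dots> = (\<Sum>m\<in>?X. \<Sum>n\<in>?Y. A (?x m) m (A (?y n) n w) - A (?y n) n (A (?x m) m w))"
      by (simp add: sum_subtractf sum.swap[of _ ?Y ?X])
    also have "\<dots> = (\<Sum>m\<in>?X. sc2 (of_int m * form (?x m) (?y (- m))) w)"
    proof (rule sum.cong[OF refl])
      fix m assume "m \<in> ?X"
      have "(\<Sum>n\<in>?Y. A (?x m) m (A (?y n) n w) - A (?y n) n (A (?x m) m w)) =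
          (\<Sum>n\<in>?Y. if n = - m then sc2 (of_int m * form (?x m) (?y (- m))) w else 0)"
        by (rule sum.cong[OF refl]) (auto simp: comm[OF hx hy])
      also have "\<dots> = sc2 (of_int m * form (?x m) (?y (- m))) w"
        by (simp add: in_keys_iff form_0_right)
      finally show "(\<Sum>n\<in>?Y. A (?x m) m (A (?y n) n w) - A (?y n) n (A (?x m) m w)) =
          sc2 (of_int m * form (?x m) (?y (- m))) w" .
    qed
    also have "\<dots> = g (heis_bracket form x y) w"
      by (simp add: g_def heis_bracket_def m.scale_sum_left)
    finally show ?thesis .
  qed
  have g_ideal: "g.ext i w = 0" if "i \<in> L.I" for i w
    by (rule g.ext_env_ideal[OF g_add g_scale g_br that])
  have g_rep: "g.ext (U_rep x) w = g.ext x w" for x w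
    using g_ideal[OF L.rep_diff[of x], of w] by (simp add: g.ext_left.diff)
  have g_nonneg: "g x v0 = sc2 (snd x) v0" if "x \<in> heis_alg_nonneg \<hh>" for x
  proof -
    have "A (Poly_Mapping.lookup (fst x) n) n v0 = 0" for n
    proof (cases "n < 0")
      case True
      then show ?thesis using that A0 by (simp add: heis_alg_nonneg_def)
    next
      case False
      then show ?thesis using that v0 by (simp add: heis_alg_nonneg_def heis_alg_iff)
    qed
    then show ?thesis by (simp add: g_def)
  qed
  have g_vac: "g.ext b v0 = sc2 (heis_vac_action b 1) v0" if "b \<in> P.F" for b
  proof -
    have "b \<in> {b. g.ext b v0 = sc2 (heis_vac_action b 1) v0}"
      using that
    proof (induction rule: free_alg_on_word_induct)
      case one
      then show ?case by (simp add: g.ext_one heis_vac_action_ext \<chi>.ext_one)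
    next
      case (letter x b)
      have "heis_vac_action (letter x * b) 1 = snd x * heis_vac_action b 1"
        by (simp only: heis_vac_action_ext \<chi>.ext_mult \<chi>.ext_letter)
      then show ?case
        using letter by (simp add: g.ext_mult g.ext_letter g.g.scale g_nonneg mult.commute)
    next
      case subspace
      show ?case
        by (auto simp: fs.subspace_def g.ext_left.zero g.ext_left.add g.ext_left.scale heis_vac_action_ext
            \<chi>.ext_left.zero \<chi>.ext_left.add \<chi>.ext_left.scale m.scale_left_distrib)
    qed
    then show ?thesis by simp
  qed
  define T where "T = lin_ext sc2 (\<lambda>(x, z). sc2 z (g.ext x v0))"
  have linT: "Vector_Spaces.linear fscale sc2 T"
    unfolding T_def by (rule linear_lin_ext[OF vs])
  interpret T: Vector_Spaces.linear fscale sc2 T by (rule linT)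
  have T_pure: "T (pure x z) = sc2 z (g.ext x v0)" for x z
    by (simp add: T_def lin_ext_single[OF vs])
  have T_rels: "T r = 0" if "r \<in> rels" for r
    using that
  proof (cases rule: rels_cases)
    case (balance x b w)
    have "heis_vac_action b w = heis_vac_action b 1 * w"
      by (simp add: heis_vac_action_def)
    then show ?thesis
      using g_vac[OF P.env_alg_cases(1)[OF balance(3)]] balance(1)
      by (simp add: T.diff T_pure g_rep g.ext_mult g.ext_right.scale mult.commute)
  qed (simp_all add: T.diff T.scale T_pure g.ext_left.add g.ext_left.scale m.scale_left_distrib
      m.scale_right_distrib mult.commute)
  have T_span: "T y = 0" if "y \<in> fs.span rels" for y
    using T.eq_0_on_span[of rels y] T_rels that by blast
  have T_rep: "T (space_rep y) = T y" for y
    using T_span[OF space_rep_diff[of y]] by (simp add: T.diff)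
  have T_q: "T (q a) = g.ext a v0" for a
    by (simp add: q_def T_rep T_pure g_rep)
  have g_mode: "g (Poly_Mapping.single n u, 0) w = A u n w" for n u w
    by (subst g_eq[of "{n}"]) auto
  show ?thesis
  proof
    show "Vector_Spaces.linear fscale sc2 T" by fact
    show "T vac = v0" by (simp add: vac_eq T_q g.ext_one)
    show "T (act u n w) = A u n (T w)" if "u \<in> \<hh>" "w \<in> space" for u n w
      using that by (auto simp: space_eq act_q T_q g.ext_mult g.ext_letter g_mode)
  qed
qed

end

section \<open>The isomorphism\<close>

context full_vertex_algebra
begin

text \<open>
  Infinite sums cause no trouble: an injective linear map preserves the support of a family, and a
  family with infinite support has sum $0$ on either side.
\<close>

lemma transport:
  fixes sc2 :: "complex \<Rightarrow> 'w::ab_group_add \<Rightarrow> 'w"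
  assumes lin: "Vector_Spaces.linear scale sc2 f" and inj: "inj f"
  shows "vertex_algebra sc2 (range f) (f vac) (\<lambda>u n w. f (Y (inv f u) n (inv f w)))"
proof -
  interpret f: Vector_Spaces.linear scale sc2 f by (rule lin)
  have inv [simp]: "inv f (f u) = u" for u
    using inj by simp
  have f0: "f v = 0 \<longleftrightarrow> v = 0" for v
    using inj f.zero by (metis injD)
  have Sum_any_f: "Sum_any (\<lambda>i. f (g i)) = f (Sum_any g)" for g :: "nat \<Rightarrow> 'v"
    by (simp add: Sum_any.expand_set f0 f.sum)
  show ?thesis
  proof (unfold_locales, goal_cases)
    case 1
    have "f.vs2.subspace (f ` UNIV)" by (rule f.subspace_image) simp
    then show ?case .
  next
    case 2
    then show ?case by simp
  next
    case (3 u v n)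
    then show ?case by simp
  next
    case (4 u u' v n)
    then show ?case by (auto simp: Y_add_left simp flip: f.add)
  next
    case (5 u v v' n)
    then show ?case by (auto simp: Y_add_right simp flip: f.add)
  next
    case (6 c u v n)
    then show ?case by (auto simp: Y_scale_left simp flip: f.scale)
  next
    case (7 c u v n)
    then show ?case by (auto simp: Y_scale_right simp flip: f.scale)
  next
    case (8 u v)
    then show ?case using truncation by (auto simp: f0)
  next
    case (9 v n)
    then show ?case by (auto simp: Y_vac f.zero)
  next
    case (10 v)
    then show ?case by (auto simp: Y_creation)
  next
    case (11 v n)
    then show ?case by (auto simp: Y_creation_nonneg f.zero)
  next
    case (12 u v w m n k)
    then obtain u' v' w' where "u = f u'" "v = f v'" "w = f w'" by auto
    then show ?case
      using borcherds[of u' v' w' m n k]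
      by (simp add: f.scale[symmetric] f.diff[symmetric] Sum_any_f)
  qed
qed

end

text \<open>
  The situation reached at the end of the first half of the argument: $V_1$ is abelian and has an
  orthonormal basis.
\<close>

locale orthonormal_voa = cft_type_voa scale vac Y \<omega>
  for scale :: "complex \<Rightarrow> 'v::ab_group_add \<Rightarrow> 'v" and vac :: 'v
    and Y :: "'v \<Rightarrow> int \<Rightarrow> 'v \<Rightarrow> 'v" and \<omega> :: 'v +
  fixes B :: "'v set"
  assumes abelian: "\<And>u v. u \<in> V1 \<Longrightarrow> v \<in> V1 \<Longrightarrow> Y u 0 v = 0"
    and orthonormal: "heisenberg.orthonormal_basis scale V1 (V1_form scale vac Y) B"
begin

lemma basis:
  "finite B" "B \<subseteq> V1" "span B = V1" "\<And>b b'. b \<in> B \<Longrightarrow> b' \<in> B \<Longrightarrow> form b b' = (if b = b' then 1 else 0)"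
  using orthonormal unfolding heisenberg.orthonormal_basis_def by blast+

lemma basis_V1: "b \<in> B \<Longrightarrow> b \<in> V1"
  using basis by blast

sublocale mod: heisenberg_module scale UNIV B Y vac
proof unfold_locales
  show "finite B" by (rule basis)
  show "Y b m (Y b' n w) - Y b' n (Y b m w) = (if b = b' \<and> m + n = 0 then scale (of_int m) w else 0)"
    if "b \<in> B" "b' \<in> B" for b b' m n w
    using heisenberg_relation[OF basis_V1 basis_V1 abelian, of b b'] basis_V1 basis(4) that by auto
  show "UNIV \<subseteq> S"
    if S: "subspace S" "vac \<in> S" "\<And>b n w. b \<in> B \<Longrightarrow> w \<in> S \<Longrightarrow> Y b n w \<in> S" for S
  proof -
    have "Y u n w \<in> S" if "u \<in> V1" "w \<in> S" for u n w
    proof -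
      have "span B \<subseteq> {u. Y u n w \<in> S}"
        by (rule span_minimal)
          (use S that in \<open>auto simp: subspace_def Y_add_left Y_scale_left\<close>)
      then show ?thesis using basis that by auto
    qed
    then show ?thesis using subspace_eq_UNIV_of_V1_modes[OF S(1,2)] by blast
  qed
qed (simp_all add: linear_Y_right Y_creation_nonneg)

text \<open>
  Compare the annihilation operators on both sides: $b_1\omega = b$ is matched by the quadratic term
  and $b_2\omega = l_b\mathbf 1$ by $h(-2)\mathbf 1$, because $b_2h_{-2}\mathbf 1 = 2\langle b,h\rangle
  \mathbf 1$.  What remains is a multiple of the vacuum of weight two.
\<close>

lemma conformal_vector:
  obtains h where "h \<in> V1"
    "\<omega> = scale (1/2) (\<Sum>b\<in>B. Y b (-1) (Y b (-1) vac)) + Y h (-2) vac"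
proof -
  have "\<exists>l. Y b 1 \<omega> = b \<and> Y b 2 \<omega> = scale l vac \<and> (\<forall>n\<ge>3. Y b n \<omega> = 0)" if "b \<in> B" for b
    using V1_modes_omega[OF basis_V1[OF that]] by metis
  then obtain l where l: "\<And>b. b \<in> B \<Longrightarrow> Y b 1 \<omega> = b" "\<And>b. b \<in> B \<Longrightarrow> Y b 2 \<omega> = scale (l b) vac"
    "\<And>b n. b \<in> B \<Longrightarrow> n \<ge> 3 \<Longrightarrow> Y b n \<omega> = 0"
    by metis
  define h where "h = (\<Sum>b\<in>B. scale (l b / 2) b)"
  define s where "s = scale (1/2) (\<Sum>b\<in>B. Y b (-1) (Y b (-1) vac))"
  define z where "z = \<omega> - s - Y h (-2) vac"
  have h: "h \<in> V1"
    unfolding h_def using basis_V1 by (intro subspace_sum subspace_scale subspace_V1)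
  have form_h: "form c h = l c / 2" if "c \<in> B" for c
  proof -
    have "form c h = (\<Sum>b\<in>B. l b / 2 * form c b)"
      unfolding h_def by (rule form_sum_right) (use basis_V1 that in auto)
    also have "\<dots> = (\<Sum>b\<in>B. if b = c then l c / 2 else 0)"
      by (rule sum.cong) (use basis(4) that in auto)
    finally show ?thesis using that basis(1) by simp
  qed
  have s: "Y c n s = (if n = 1 then c else 0)" if "c \<in> B" "n > 0" for c n
  proof -
    have "Y c n (Y b (-1) (Y b (-1) vac)) = (if b = c then if n = 1 then scale 2 c else 0 else 0)"
      if "b \<in> B" for b
      using mod.A_swap[OF \<open>c \<in> B\<close> that, of "Y b (-1) vac" n "-1"]
        mod.A_swap[OF \<open>c \<in> B\<close> that, of vac n "-1"] \<open>n > 0\<close> scale_left_distrib[of 1 1 c]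
      by (auto simp: Y_creation_nonneg Y_creation)
    then show ?thesis
      using \<open>c \<in> B\<close> basis(1) by (simp add: s_def Y_scale_right Y_right.sum)
  qed
  have hh: "Y c n (Y h (-2) vac) = (if n = 2 then scale (l c) vac else 0)" if "c \<in> B" "n > 0" for c n
    using heisenberg_relation[OF basis_V1[OF that(1)] h abelian[OF basis_V1[OF that(1)] h], of n "-2" vac]
      form_h[OF that(1)] that(2)
    by (auto simp: Y_creation_nonneg mult.commute)
  have "Y c n z = 0" if "c \<in> B" "n > 0" for c n
  proof -
    consider "n = 1" | "n = 2" | "n \<ge> 3" using \<open>n > 0\<close> by linarith
    then show ?thesis
      by cases (use that in \<open>simp_all add: z_def Y_right.diff s hh l\<close>)
  qed
  then obtain k where k: "z = scale k vac"
    using mod.singular_vector[of z] by auto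
  have L0_vac: "Y \<omega> 1 vac = 0" by (simp add: Y_creation_nonneg)
  have "Y \<omega> 1 (Y b (-1) (Y b (-1) vac)) = scale 2 (Y b (-1) (Y b (-1) vac))" if "b \<in> B" for b
    using scale_left_distrib[of 1 1 "Y b (-1) (Y b (-1) vac)"]
    by (simp add: L0_commutator basis_V1 that L0_vac Y_right.add)
  then have "Y \<omega> 1 s = scale 2 s"
    by (simp add: s_def Y_scale_right Y_right.sum scale_sum_right)
  moreover have "Y \<omega> 1 (Y h (-2) vac) = scale 2 (Y h (-2) vac)"
    by (simp add: L0_commutator h L0_vac)
  ultimately have "Y \<omega> 1 z = scale 2 z"
    by (simp add: z_def Y_right.diff L0_omega scale_right_diff_distrib)
  then have "z = 0"
    by (simp add: k Y_scale_right L0_vac)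
  then have "\<omega> = s + Y h (-2) vac" by (simp add: z_def algebra_simps)
  then show ?thesis using that h s_def by blast
qed

sublocale H: heisenberg_induced scale V1 form
  by unfold_locales (rule subspace_V1, simp_all)

text \<open>
  Lets the modes of a basis stand in for the modes of all of $V_1$.
\<close>

lemma act_span:
  assumes S: "fs.subspace S" and w: "w \<in> H.space"
    and act: "\<And>b. b \<in> B \<Longrightarrow> H.act b n w \<in> S" and u: "u \<in> V1"
  shows "H.act u n w \<in> S"
proof -
  have V0: "0 \<in> V1" by (rule subspace_0[OF subspace_V1])
  have "span B \<subseteq> {u \<in> V1. H.act u n w \<in> S}"
  proof (rule span_minimal)
    show "B \<subseteq> {u \<in> V1. H.act u n w \<in> S}" using act basis_V1 by blast
    show "subspace {u \<in> V1. H.act u n w \<in> S}"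
      unfolding subspace_def
      using V0 subspace_add[OF subspace_V1] subspace_scale[OF subspace_V1] fs.subspace_0[OF S]
        fs.subspace_add[OF S] fs.subspace_scale[OF S] H.act_scale_left[OF V0 w, of 0 n]
      by (auto simp: H.act_add_left[OF _ _ w] H.act_scale_left[OF _ w])
  qed
  then show ?thesis using u basis(3) by blast
qed

sublocale Hmod: heisenberg_module fscale H.space B H.act H.vac
proof (intro heisenberg_module.intro heisenberg_module_axioms.intro vector_space_fscale)
  show "finite B" by (rule basis)
  show "fs.subspace H.space" by (rule H.subspace_space)
  show "H.vac \<in> H.space" by (rule H.vac_space)
  show "Vector_Spaces.linear fscale fscale (H.act b n)" for b n by (rule H.linear_act)
  show "H.act b n w \<in> H.space" if "b \<in> B" "w \<in> H.space" for b n w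
    using H.act_space basis_V1 that by blast
  show "H.act b m (H.act b' n w) - H.act b' n (H.act b m w) =
      (if b = b' \<and> m + n = 0 then fscale (of_int m) w else 0)"
    if "b \<in> B" "b' \<in> B" "w \<in> H.space" for b b' m n w
    using H.act_commutator[OF basis_V1 basis_V1, of b b' w] basis(4) that by auto
  show "H.act b n H.vac = 0" if "b \<in> B" "n \<ge> 0" for b n
    using H.act_vac basis_V1 that by blast
  show "H.space \<subseteq> S"
    if S: "fs.subspace S" "H.vac \<in> S" "\<And>b n w. b \<in> B \<Longrightarrow> w \<in> S \<Longrightarrow> H.act b n w \<in> S" for S
    by (rule H.space_cyclic[OF S(1,2)]) (rule act_span[OF S(1)], use S(3) in auto)
qed

text \<open>
  The kernel is stable under the modes and misses the vacuum, so irreducibility makes the map injective;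
  the image is stable under the modes of $V_1$ and contains the vacuum.
\<close>

lemma iso_from_heisenberg:
  obtains T where "Vector_Spaces.linear fscale scale T" "T H.vac = vac"
    "\<And>u n w. u \<in> V1 \<Longrightarrow> w \<in> H.space \<Longrightarrow> T (H.act u n w) = Y u n (T w)"
    "bij_betw T H.space UNIV"
proof -
  obtain T where T: "Vector_Spaces.linear fscale scale T" "T H.vac = vac"
    "\<And>u n w. u \<in> V1 \<Longrightarrow> w \<in> H.space \<Longrightarrow> T (H.act u n w) = Y u n (T w)"
  proof (rule H.universal[of scale Y vac])
    show "vector_space scale" by (rule vector_space_axioms)
    show "Vector_Spaces.linear scale scale (Y u n)" for u n by (rule linear_Y_right)
    show "Y u m (Y v n w) - Y v n (Y u m w) = (if m + n = 0 then scale (of_int m * form u v) w else 0)"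
      if "u \<in> V1" "v \<in> V1" for u v m n w
      by (rule heisenberg_relation[OF that abelian[OF that]])
  qed (simp_all add: Y_add_left Y_scale_left Y_creation_nonneg)
  interpret T: Vector_Spaces.linear fscale scale T by (rule T(1))
  have ker: "y = 0" if "y \<in> H.space" "T y = 0" for y
  proof (rule Hmod.irreducible[of "{y. T y = 0}"])
    show "fs.subspace {y. T y = 0}" by (auto simp: fs.subspace_def T.zero T.add T.scale)
  qed (use that T(2) vac_nonzero T(3) basis_V1 in auto)
  have inj: "inj_on T H.space"
  proof (rule inj_onI)
    fix x y assume xy: "x \<in> H.space" "y \<in> H.space" "T x = T y"
    have "x - y = 0"
      by (rule ker) (use xy fs.subspace_diff[OF H.subspace_space] in \<open>auto simp: T.diff\<close>)
    then show "x = y" by simp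
  qed
  have "T ` H.space = UNIV"
  proof (rule subspace_eq_UNIV_of_V1_modes)
    show "subspace (T ` H.space)" by (rule T.subspace_image[OF H.subspace_space])
    show "vac \<in> T ` H.space" using T(2) H.vac_space by (metis imageI)
    show "Y u n w \<in> T ` H.space" if "u \<in> V1" "w \<in> T ` H.space" for u n w
      using that T(3) H.act_space by (auto simp: image_iff) metis
  qed
  with inj T that show ?thesis by (auto simp: bij_betw_def)
qed

theorem isomorphic_heisenberg:
  "\<exists>h\<in>V1. \<exists>YH. H.is_vertex_structure YH \<and>
    voa_isomorphic scale UNIV vac Y \<omega> fscale H.space H.vac YH (H.conformal B h)"
proof -
  obtain T where T: "Vector_Spaces.linear fscale scale T" "T H.vac = vac"
    "\<And>u n w. u \<in> V1 \<Longrightarrow> w \<in> H.space \<Longrightarrow> T (H.act u n w) = Y u n (T w)"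
    "bij_betw T H.space UNIV"
    by (rule iso_from_heisenberg) blast
  interpret T: Vector_Spaces.linear fscale scale T by (rule T(1))
  obtain h where h: "h \<in> V1"
    "\<omega> = scale (1/2) (\<Sum>b\<in>B. Y b (-1) (Y b (-1) vac)) + Y h (-2) vac"
    by (rule conformal_vector)
  define f where "f = inv_into H.space T"
  have Tf: "T (f v) = v" and f_space: "f v \<in> H.space" for v
    using T(4) by (auto simp: f_def bij_betw_def f_inv_into_f inv_into_into)
  have fT: "f (T w) = w" if "w \<in> H.space" for w
    using T(4) that by (auto simp: f_def bij_betw_def inv_into_f_f)
  have lin_f: "Vector_Spaces.linear scale fscale f"
  proof unfold_locales
    show "f (u + v) = f u + f v" for u v
      using fT[of "f u + f v"] fs.subspace_add[OF H.subspace_space f_space f_space]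
      by (simp add: T.add Tf)
    show "f (scale c u) = fscale c (f u)" for c u
      using fT[of "fscale c (f u)"] fs.subspace_scale[OF H.subspace_space f_space]
      by (simp add: T.scale Tf)
  qed
  interpret f: Vector_Spaces.linear scale fscale f by (rule lin_f)
  have inj_f: "inj f" by (rule inj_on_inverseI[of _ T]) (rule Tf)
  have range_f: "range f = H.space"
    using f_space fT by (auto simp: image_iff) metis
  have inv_f: "inv f w = T w" if "w \<in> H.space" for w
    using inv_f_f[OF inj_f, of "T w"] fT[OF that] by simp
  have f_vac: "f vac = H.vac" using fT[OF H.vac_space] T(2) by simp
  define YH where "YH u n w = f (Y (inv f u) n (inv f w))" for u n w
  have "H.is_vertex_structure YH"
    unfolding H.is_vertex_structure_def
  proof (intro conjI ballI allI)
    show "vertex_algebra fscale H.space H.vac YH"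
      using transport[OF lin_f inj_f] by (simp add: range_f f_vac YH_def[abs_def])
    fix u n w assume uw: "u \<in> V1" "w \<in> H.space"
    have "T (H.act u (- 1) H.vac) = u"
      using T(2,3) uw H.vac_space by (simp add: Y_creation)
    then have "YH (H.act u (- 1) H.vac) n w = f (T (H.act u n w))"
      using uw T(3) by (simp add: YH_def inv_f H.act_space H.vac_space)
    then show "YH (H.act u (- 1) H.vac) n w = H.act u n w"
      using fT H.act_space uw by simp
  qed
  moreover have "voa_isomorphic scale UNIV vac Y \<omega> fscale H.space H.vac YH (H.conformal B h)"
    unfolding voa_isomorphic_def
  proof (intro exI[of _ f] conjI ballI allI)
    show "bij_betw f UNIV H.space" using inj_f range_f by (simp add: bij_betw_def)
    show "f (u + v) = f u + f v" for u v by (rule f.add)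
    show "f (scale c u) = fscale c (f u)" for c u by (rule f.scale)
    show "f vac = H.vac" by (rule f_vac)
    show "f (Y u n v) = YH (f u) n (f v)" for u n v
      using inj_f by (simp add: YH_def)
    have bb: "H.act b (-1) (H.act b (-1) H.vac) \<in> H.space" if "b \<in> B" for b
      using that basis_V1 H.act_space H.vac_space by blast
    have conf: "H.conformal B h \<in> H.space"
      unfolding H.conformal_def using bb h(1) H.act_space H.vac_space
      by (intro fs.subspace_add[OF H.subspace_space] fs.subspace_scale[OF H.subspace_space]
          fs.subspace_sum[OF H.subspace_space]) auto
    have "T (H.conformal B h) = scale (1/2) (\<Sum>b\<in>B. Y b (-1) (Y b (-1) vac)) + Y h (-2) vac"
      unfolding H.conformal_def
      using h(1) basis_V1 T(2) by (simp add: T.add T.scale T.sum T(3) H.act_space H.vac_space)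
    then have "T (H.conformal B h) = \<omega>" unfolding h(2)[symmetric] .
    then show "f \<omega> = H.conformal B h" using fT[OF conf] by simp
  qed
  ultimately show ?thesis using h(1) by blast
qed

end

lemma cft_type_voa_of_nondegenerate:
  fixes scale :: "complex \<Rightarrow> 'v::ab_group_add \<Rightarrow> 'v"
  assumes V: "nondegenerate_simple_CFT_type scale vac Y \<omega>"
  shows "cft_type_voa scale vac Y \<omega>"
proof -
  note V' = V[unfolded nondegenerate_simple_CFT_type_def Let_def]
  interpret vertex_operator_algebra scale UNIV vac Y \<omega> using V' by blast
  interpret full_vertex_algebra scale vac Y ..
  have "vac \<noteq> 0"
  proof
    assume "vac = 0"
    then have "v = 0" for v :: 'v using Y_vac[where v = v and n = "-1"] by simp
    then have "UNIV = {0 :: 'v}" by auto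
    then show False using V' by (simp add: simple_vertex_algebra_def)
  qed
  then show ?thesis
    by unfold_locales (use V' in auto)
qed

theorem theorem1p8:
  fixes scale :: "complex \<Rightarrow> 'v::ab_group_add \<Rightarrow> 'v"
    and vac \<omega> :: 'v
    and Y :: "'v \<Rightarrow> int \<Rightarrow> 'v \<Rightarrow> 'v"
    and V1 :: "'v set"
    and d :: nat
    and \<omega>s :: "nat \<Rightarrow> 'v"
  defines "V1 \<equiv> weight_space scale UNIV Y \<omega> 1"
  defines "d \<equiv> vector_space.dim scale V1"
  assumes V: "nondegenerate_simple_CFT_type scale vac Y \<omega>"
    and sc: "\<And>i. i \<le> d \<Longrightarrow> \<omega>s i \<in> semi_conformal scale vac Y \<omega>"
    and first: "\<omega>s 0 = 0"
    and last: "\<omega>s d = \<omega>"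
    and chain: "\<And>i. i < d \<Longrightarrow> sc_less scale Y (\<omega>s i) (\<omega>s (Suc i))"
    and comm: "\<And>i. i \<in> {1..d} \<Longrightarrow>
      vector_space.dim scale
        (commutant Y (commutant Y (generated_subalgebra scale vac Y {\<omega>s i - \<omega>s (i - 1)})) \<inter> V1) \<noteq> 0"
  shows "\<exists>h\<in>V1. \<exists>YH B.
    heisenberg.is_vertex_structure scale V1 (V1_form scale vac Y) YH \<and>
    heisenberg.orthonormal_basis scale V1 (V1_form scale vac Y) B \<and>
    voa_isomorphic scale UNIV vac Y \<omega>
      fscale (heisenberg.space scale V1 (V1_form scale vac Y))
      (heisenberg.vac scale V1 (V1_form scale vac Y)) YH
      (heisenberg.conformal scale V1 (V1_form scale vac Y) B h)"
proof -
  interpret cft_type_voa scale vac Y \<omega>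
    by (rule cft_type_voa_of_nondegenerate[OF V])
  have le: "sc_le scale Y (\<omega>s i) (\<omega>s (Suc i))" if "i < d" for i
    using chain[OF that] by (simp add: sc_less_def)
  obtain X where X: "finite X" "card X = d" "independent X" "X \<subseteq> V1"
    and comm_X: "\<And>x y n. x \<in> X \<Longrightarrow> y \<in> X \<Longrightarrow> x \<noteq> y \<Longrightarrow> n \<ge> 0 \<Longrightarrow> Y x n y = 0"
    using commuting_independent_vectors_of_chain[OF sc le first last comm[unfolded V1_def]]
    unfolding V1_def by metis
  have span_X: "span X = V1"
    using V1_span_of_card[of X] X by (simp add: V1_def d_def)
  obtain B where B: "heisenberg.orthonormal_basis scale V1 (V1_form scale vac Y) B"
    using orthonormal_basis_of_commuting_basis[of X] X span_X comm_X unfolding V1_def by metis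
  interpret orthonormal_voa scale vac Y \<omega> B
    by unfold_locales
      (use Y_bracket_zero_of_basis[of X] X span_X comm_X B in \<open>auto simp: V1_def\<close>)
  show ?thesis
    using isomorphic_heisenberg B unfolding V1_def by blast
qed

end
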